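(* Let $A\in\mathrm{GL}(n,\mathbb{H})$ be an arbitrary reversible element. Suppose that in the Jordan decomposition of $A$ every Jordan block corresponding to non-real eigenvalue classes of unit modulus has even multiplicity; that is, for every $\mu\in\mathbb{C}$ with $|\mu|=1$ and positive imaginary part and every integer $m\geq1$, the block $\mathrm{J}(\mu,m)$ occurs an even number (possibly zero) of times in the Jordan form of $A$. Then $A$ is strongly reversible in $\mathrm{GL}(n,\mathbb{H})$.
   Context: $\mathbb{H}=\mathbb{R}+\mathbb{R}\mathbf{i}+\mathbb{R}\mathbf{j}+\mathbb{R}\mathbf{k}$ denotes the quaternions, with $\mathbb{C}=\mathbb{R}+\mathbb{R}\mathbf{i}\subset\mathbb{H}$. An element $g$ of a group $G$ is reversible in $G$ if $hgh^{-1}=g^{-1}$ for some $h\in G$; it is strongly reversible in $G$ if such an $h$ can be chosen to be an involution, i.e. an element of order at most two ($h^2=1$). $\mathrm{J}(\lambda,m)$ is the $m\times m$ matrix with $\lambda$ on the diagonal, $1$ on all superdiagonal entries, and $0$ elsewhere. Jordan form over $\mathbb{H}$: every $A\in\mathrm{M}(n,\mathbb{H})$ is conjugate under $\mathrm{GL}(n,\mathbb{H})$ to a block diagonal matrix $\mathrm{J}(\lambda_1,m_1)\oplus\cdots\oplus\mathrm{J}(\lambda_k,m_k)$, unique up to permutation of blocks, with $\lambda_1,\dots,\lambda_k\in\mathbb{C}$ (not necessarily distinct) having non-negative imaginary parts. Right eigenvalues of $A$ occur in similarity classes in $\mathbb{H}$, each represented by its unique complex element with non-negative imaginary part. *)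

theory Defs
  imports
    "HOL-Analysis.Analysis"
    "HOL-Algebra.Group"
    "Jordan_Normal_Form.Jordan_Normal_Form"
begin

datatype quat = Quat (qRe: real) (qIm1: real) (qIm2: real) (qIm3: real)

lemma quat_eq_iff:
  "x = y \<longleftrightarrow> qRe x = qRe y \<and> qIm1 x = qIm1 y \<and> qIm2 x = qIm2 y \<and> qIm3 x = qIm3 y"
  by (cases x; cases y) auto

instantiation quat :: division_ring
begin

definition zero_quat :: quat where
  "0 = Quat 0 0 0 0"

definition one_quat :: quat where
  "1 = Quat 1 0 0 0"

definition plus_quat :: "quat \<Rightarrow> quat \<Rightarrow> quat" where
  "x + y = Quat (qRe x + qRe y) (qIm1 x + qIm1 y) (qIm2 x + qIm2 y) (qIm3 x + qIm3 y)"

definition uminus_quat :: "quat \<Rightarrow> quat" where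
  "- x = Quat (- qRe x) (- qIm1 x) (- qIm2 x) (- qIm3 x)"

definition minus_quat :: "quat \<Rightarrow> quat \<Rightarrow> quat" where
  "x - y = Quat (qRe x - qRe y) (qIm1 x - qIm1 y) (qIm2 x - qIm2 y) (qIm3 x - qIm3 y)"

definition times_quat :: "quat \<Rightarrow> quat \<Rightarrow> quat" where
  "x * y = Quat
     (qRe x * qRe y - qIm1 x * qIm1 y - qIm2 x * qIm2 y - qIm3 x * qIm3 y)
     (qRe x * qIm1 y + qIm1 x * qRe y + qIm2 x * qIm3 y - qIm3 x * qIm2 y)
     (qRe x * qIm2 y - qIm1 x * qIm3 y + qIm2 x * qRe y + qIm3 x * qIm1 y)
     (qRe x * qIm3 y + qIm1 x * qIm2 y - qIm2 x * qIm1 y + qIm3 x * qRe y)"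

definition inverse_quat :: "quat \<Rightarrow> quat" where
  "inverse x = (let s = (qRe x)\<^sup>2 + (qIm1 x)\<^sup>2 + (qIm2 x)\<^sup>2 + (qIm3 x)\<^sup>2
     in Quat (qRe x / s) (- qIm1 x / s) (- qIm2 x / s) (- qIm3 x / s))"

definition divide_quat :: "quat \<Rightarrow> quat \<Rightarrow> quat" where
  "x div y = x * inverse (y :: quat)"

lemmas quat_arith_defs =
  zero_quat_def one_quat_def plus_quat_def uminus_quat_def minus_quat_def times_quat_def

lemma quat_norm_sq_eq_0:
  "(qRe x)\<^sup>2 + (qIm1 x)\<^sup>2 + (qIm2 x)\<^sup>2 + (qIm3 x)\<^sup>2 = 0 \<longleftrightarrow> x = 0"
proof
  assume h: "(qRe x)\<^sup>2 + (qIm1 x)\<^sup>2 + (qIm2 x)\<^sup>2 + (qIm3 x)\<^sup>2 = 0"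
  have "(qRe x)\<^sup>2 \<ge> 0" "(qIm1 x)\<^sup>2 \<ge> 0" "(qIm2 x)\<^sup>2 \<ge> 0" "(qIm3 x)\<^sup>2 \<ge> 0"
    by simp_all
  with h have "(qRe x)\<^sup>2 = 0" "(qIm1 x)\<^sup>2 = 0" "(qIm2 x)\<^sup>2 = 0" "(qIm3 x)\<^sup>2 = 0"
    by linarith+
  thus "x = 0"
    by (simp add: quat_eq_iff zero_quat_def)
qed (simp add: zero_quat_def)

instance
proof
  fix x :: quat
  assume nz: "x \<noteq> 0"
  define s where "s = (qRe x)\<^sup>2 + (qIm1 x)\<^sup>2 + (qIm2 x)\<^sup>2 + (qIm3 x)\<^sup>2"
  have s: "s \<noteq> 0"
    using nz quat_norm_sq_eq_0[of x] by (simp add: s_def)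
  have inv: "inverse x = Quat (qRe x / s) (- qIm1 x / s) (- qIm2 x / s) (- qIm3 x / s)"
    by (simp add: inverse_quat_def s_def Let_def)
  have norm1: "qRe x * qRe x / s + qIm1 x * qIm1 x / s + qIm2 x * qIm2 x / s + qIm3 x * qIm3 x / s = 1"
    using s by (simp add: s_def power2_eq_square flip: add_divide_distrib)
  show "inverse x * x = 1"
    using norm1 by (simp add: inv times_quat_def one_quat_def mult.commute)
  show "x * inverse x = 1"
    using norm1 by (simp add: inv times_quat_def one_quat_def mult.commute)
qed (simp_all add: quat_arith_defs inverse_quat_def divide_quat_def quat_eq_iff algebra_simps)

end

definition quat_of_complex :: "complex \<Rightarrow> quat" where
  "quat_of_complex z = Quat (Re z) (Im z) 0 0"

definition reversible :: "('a, 'b) monoid_scheme \<Rightarrow> 'a \<Rightarrow> bool" where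
  "reversible G g \<longleftrightarrow>
     g \<in> carrier G \<and> (\<exists>h\<in>carrier G. h \<otimes>\<^bsub>G\<^esub> g \<otimes>\<^bsub>G\<^esub> inv\<^bsub>G\<^esub> h = inv\<^bsub>G\<^esub> g)"

definition strongly_reversible :: "('a, 'b) monoid_scheme \<Rightarrow> 'a \<Rightarrow> bool" where
  "strongly_reversible G g \<longleftrightarrow>
     g \<in> carrier G \<and>
     (\<exists>h\<in>carrier G. h \<otimes>\<^bsub>G\<^esub> h = \<one>\<^bsub>G\<^esub> \<and> h \<otimes>\<^bsub>G\<^esub> g \<otimes>\<^bsub>G\<^esub> inv\<^bsub>G\<^esub> h = inv\<^bsub>G\<^esub> g)"

definition GL_quat :: "nat \<Rightarrow> quat mat monoid" where
  "GL_quat n = units_of (ring_mat TYPE(quat) n ())"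

lemma group_GL_quat: "group (GL_quat n)"
proof -
  interpret semiring "ring_mat TYPE(quat) n ()"
    by (rule semiring_mat)
  show ?thesis
    unfolding GL_quat_def by (rule units_group)
qed

lemma carrier_GL_quat:
  "carrier (GL_quat n) =
     {A \<in> carrier_mat n n. \<exists>B\<in>carrier_mat n n. B * A = 1\<^sub>m n \<and> A * B = 1\<^sub>m n}"
  by (simp add: GL_quat_def units_of_def Units_def ring_mat_simps)

text \<open>A list entry \<open>(m, \<mu>)\<close> stands for the block \<open>J(\<mu>, m)\<close>. The predicate \<^const>\<open>jordan_nf\<close>
  expresses similarity over the quaternions here and requires all blocks to have positive size.\<close>

definition quat_jordan_form :: "quat mat \<Rightarrow> (nat \<times> complex) list \<Rightarrow> bool" where
  "quat_jordan_form A bs \<longleftrightarrow>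
     (\<forall>(m, \<mu>)\<in>set bs. Im \<mu> \<ge> 0) \<and>
     jordan_nf A (map (\<lambda>(m, \<mu>). (m, quat_of_complex \<mu>)) bs)"

end

theory Submission
  imports Defs
    "Jordan_Normal_Form.Jordan_Normal_Form_Existence"
    "Jordan_Normal_Form.Jordan_Normal_Form_Uniqueness"
begin

text \<open>Write a quaternionic matrix as \<open>A = A\<^sub>1 + A\<^sub>2 j\<close> with complex \<open>A\<^sub>1, A\<^sub>2\<close> and let \<open>\<chi>(A)\<close> be the usual
  complex \<open>2n \<times> 2n\<close> matrix. Quaternionic matrices are similar iff their images under \<open>\<chi>\<close> are, so
  everything can be read off from the complex Jordan form of \<open>\<chi>(A)\<close>. Its blocks are stable under
  conjugation, and those with real eigenvalue have even multiplicity; hence they are \<open>b + b\<^sup>*\<close> for the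
  blocks \<open>b\<close> of a quaternionic Jordan form of \<open>A\<close>. Reversibility makes \<open>b\<close> stable under
  \<open>\<lambda> \<mapsto> 1 / \<lambda>\<^sup>*\<close>. With the parity hypothesis, \<open>b\<close> splits into pairs of blocks for \<open>\<lambda>\<close> and \<open>1 / \<lambda>\<^sup>*\<close>, each
  similar over the quaternions to \<open>J \<oplus> J\<^sup>-\<^sup>1\<close>, which is reversed by swapping the summands, and single blocks
  with \<open>\<lambda> = \<plusminus>1\<close>, which are reversed by an alternating diagonal sign matrix in a suitable basis.\<close>

section \<open>Generalized eigenspaces\<close>

lemma pow_mat_intertwine:
  fixes A B X :: "'a :: semiring_1 mat"
  assumes A: "A \<in> carrier_mat n n" and B: "B \<in> carrier_mat n n" and X: "X \<in> carrier_mat n n"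
    and AX: "A * X = X * B"
  shows "A ^\<^sub>m k * X = X * B ^\<^sub>m k"
proof (induction k)
  case 0
  then show ?case using assms by simp
next
  case (Suc k)
  have P: "A ^\<^sub>m k \<in> carrier_mat n n" "B ^\<^sub>m k \<in> carrier_mat n n" using A B by simp_all
  have "A ^\<^sub>m Suc k * X = A ^\<^sub>m k * X * B"
    using assoc_mult_mat[OF P(1) A X] assoc_mult_mat[OF P(1) X B] AX by simp
  also have "\<dots> = X * B ^\<^sub>m Suc k"
    using assoc_mult_mat[OF X P(2) B] Suc by simp
  finally show ?case .
qed

lemma pow_mat_mult_commuting:
  fixes A :: "'a :: semiring_1 mat"
  assumes A: "A \<in> carrier_mat n n" and B: "B \<in> carrier_mat n n" and AB: "A * B = B * A"
  shows "(A * B) ^\<^sub>m k = A ^\<^sub>m k * B ^\<^sub>m k"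
proof (induction k)
  case 0
  then show ?case using assms by simp
next
  case (Suc k)
  have P: "A ^\<^sub>m k \<in> carrier_mat n n" and Q: "B ^\<^sub>m k \<in> carrier_mat n n" using assms by simp_all
  have "(A * B) ^\<^sub>m Suc k = A ^\<^sub>m k * (B ^\<^sub>m k * (A * B))"
    using Suc assoc_mult_mat[OF P Q mult_carrier_mat[OF A B]] by simp
  also have "B ^\<^sub>m k * (A * B) = (A * B ^\<^sub>m k) * B"
    using assoc_mult_mat[OF Q A B] pow_mat_intertwine[OF B B A AB[symmetric]] by simp
  also have "\<dots> = A * B ^\<^sub>m Suc k"
    using assoc_mult_mat[OF A Q B] by simp
  also have "A ^\<^sub>m k * \<dots> = A ^\<^sub>m Suc k * B ^\<^sub>m Suc k"
    using assoc_mult_mat[OF P A, of "B ^\<^sub>m Suc k" n] Q B by simp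
  finally show ?case .
qed

lemma one_pow_mat: "(1\<^sub>m n) ^\<^sub>m k = (1\<^sub>m n :: 'a :: semiring_1 mat)"
  by (induction k) auto

text \<open>Since \<open>U\<close> and \<open>V\<close> commute, the power splits as
  \<open>U ^\<^sub>m k * V ^\<^sub>m k\<close>, and the invertible left factor does not change the
  kernel.\<close>

lemma kernel_dim_unit_mult_pow:
  fixes U V W :: "'a :: field mat"
  assumes U: "U \<in> carrier_mat n n" and V: "V \<in> carrier_mat n n" and W: "W \<in> carrier_mat n n"
    and UV: "U * V = V * U" and UW: "U * W = 1\<^sub>m n" and WU: "W * U = 1\<^sub>m n"
  shows "kernel_dim ((U * V) ^\<^sub>m k) = kernel_dim (V ^\<^sub>m k)"
proof -
  have "W ^\<^sub>m k * U ^\<^sub>m k = 1\<^sub>m n"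
    using pow_mat_mult_commuting[OF W U, of k] UW WU by (simp add: one_pow_mat)
  then have "mat_kernel (U ^\<^sub>m k * V ^\<^sub>m k) = mat_kernel (V ^\<^sub>m k)"
    using U V W by (intro mat_kernel_mult_eq[of _ n n _ "W ^\<^sub>m k"]) auto
  then show ?thesis
    using U V unfolding pow_mat_mult_commuting[OF U V UV] kernel_dim_def by simp
qed

text \<open>For \<open>e \<noteq> 0\<close> the matrix B - 1/e factors as (-1/e) B (A - e), where
  (-1/e) B is invertible and commutes with A - e.\<close>

lemma dim_gen_eigenspace_inverse:
  fixes A B :: "'a :: field mat"
  assumes A: "A \<in> carrier_mat n n" and B: "B \<in> carrier_mat n n"
    and AB: "A * B = 1\<^sub>m n" and BA: "B * A = 1\<^sub>m n"
  shows "dim_gen_eigenspace B (inverse e) k = dim_gen_eigenspace A e k"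
proof (cases "e = 0")
  case True
  \<comment> \<open>As \<open>inverse 0 = 0\<close>, both sides concern the eigenvalue 0. An
    invertible \<open>X\<close> is a unit times the identity, so its powers have the kernel
    dimension of the identity.\<close>
  have "kernel_dim (X ^\<^sub>m k) = kernel_dim (1\<^sub>m n ^\<^sub>m k :: 'a mat)"
    if X: "X \<in> carrier_mat n n" and Y: "Y \<in> carrier_mat n n" and XY: "X * Y = 1\<^sub>m n" "Y * X = 1\<^sub>m n"
    for X Y :: "'a mat"
    using kernel_dim_unit_mult_pow[OF X one_carrier_mat Y _ XY] X by simp
  moreover have "char_matrix A 0 = A" "char_matrix B 0 = B"
    using A B by (auto simp: char_matrix_def)
  ultimately show ?thesis
    using True A B AB BA unfolding dim_gen_eigenspace_def by simp
next
  case e: False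
  let ?U = "(- inverse e) \<cdot>\<^sub>m B" and ?W = "(- e) \<cdot>\<^sub>m A" and ?V = "char_matrix A e"
  have U: "?U \<in> carrier_mat n n" and W: "?W \<in> carrier_mat n n" and V: "?V \<in> carrier_mat n n"
    using A B by auto
  have BV: "B * ?V = 1\<^sub>m n + (- e) \<cdot>\<^sub>m B" and VB: "?V * B = 1\<^sub>m n + (- e) \<cdot>\<^sub>m B"
    using A B AB BA mult_add_distrib_mat[OF B A, of "(- e) \<cdot>\<^sub>m 1\<^sub>m n"]
      add_mult_distrib_mat[OF A, of "(- e) \<cdot>\<^sub>m 1\<^sub>m n" B n]
      mult_smult_distrib[OF B one_carrier_mat, of "- e"] mult_smult_assoc_mat[OF one_carrier_mat B, of "- e"]
    unfolding char_matrix_def by simp_all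
  have UV: "?U * ?V = char_matrix B (inverse e)"
    using B V e by (simp add: mult_smult_assoc_mat[OF B V] BV)
      (rule eq_matI, auto simp: char_matrix_def field_simps)
  have VU: "?V * ?U = char_matrix B (inverse e)"
    using B V e by (simp add: mult_smult_distrib[OF V B] VB)
      (rule eq_matI, auto simp: char_matrix_def field_simps)
  have "?U * ?W = 1\<^sub>m n" "?W * ?U = 1\<^sub>m n"
    using A B AB BA e
    by (simp_all add: mult_smult_distrib[of _ n n _ n] mult_smult_assoc_mat[of _ n n _ n])
      (auto intro!: eq_matI)
  then show ?thesis
    using kernel_dim_unit_mult_pow[OF U V W] UV VU unfolding dim_gen_eigenspace_def by simp
qed

text \<open>The conjugating matrix permutes the two groups of coordinates. This is what allows
  Jordan blocks to be reordered.\<close>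

lemma similar_mat_four_block_swap:
  fixes A B :: "'a :: semiring_1 mat"
  assumes A: "A \<in> carrier_mat n n" and B: "B \<in> carrier_mat m m"
  shows "similar_mat (four_block_mat A (0\<^sub>m n m) (0\<^sub>m m n) B) (four_block_mat B (0\<^sub>m m n) (0\<^sub>m n m) A)"
proof (rule similar_matI)
  let ?P = "four_block_mat (0\<^sub>m n m) (1\<^sub>m n) (1\<^sub>m m) (0\<^sub>m m n) :: 'a mat"
  let ?Q = "four_block_mat (0\<^sub>m m n) (1\<^sub>m m) (1\<^sub>m n) (0\<^sub>m n m) :: 'a mat"
  let ?L = "four_block_mat A (0\<^sub>m n m) (0\<^sub>m m n) B"
  let ?R = "four_block_mat B (0\<^sub>m m n) (0\<^sub>m n m) A"
  have P: "?P \<in> carrier_mat (n + m) (n + m)"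
    by (rule carrier_matI) auto
  have Q: "?Q \<in> carrier_mat (n + m) (n + m)"
    by (rule carrier_matI) auto
  have R: "?R \<in> carrier_mat (n + m) (n + m)"
    using A B by (intro carrier_matI) auto
  show "{?L, ?R, ?P, ?Q} \<subseteq> carrier_mat (n + m) (n + m)"
    using P Q R A B by auto
  show "?P * ?Q = 1\<^sub>m (n + m)"
    by (subst mult_four_block_mat[of _ n m _ n _ m _ _ n _ m]) auto
  show "?Q * ?P = 1\<^sub>m (n + m)"
    by (subst mult_four_block_mat[of _ m n _ m _ n _ _ m _ n]) (auto simp: add.commute)
  have "?P * ?R = four_block_mat (0\<^sub>m n m) A B (0\<^sub>m m n)"
    using A B by (subst mult_four_block_mat[of _ n m _ n _ m _ _ m _ n]) auto
  then show "?L = ?P * ?R * ?Q"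
    using A B by (simp, subst mult_four_block_mat[of _ n m _ n _ m _ _ n _ m]) auto
qed

section \<open>The multiset of Jordan blocks\<close>

lemma jordan_matrix_append:
  "jordan_matrix (xs @ ys) = four_block_mat (jordan_matrix xs)
     (0\<^sub>m (sum_list (map fst xs)) (sum_list (map fst ys)))
     (0\<^sub>m (sum_list (map fst ys)) (sum_list (map fst xs))) (jordan_matrix ys)"
proof -
  have "jordan_matrix (xs @ ys) = diag_block_mat (map (\<lambda>(n, a). jordan_block n a) xs @ map (\<lambda>(n, a). jordan_block n a) ys)"
    by (simp add: jordan_matrix_def)
  then show ?thesis
    unfolding diag_block_mat_append Let_def jordan_matrix_def[symmetric] by simp
qed

lemma similar_jordan_matrix_append_commute:
  "similar_mat (jordan_matrix (xs @ ys)) (jordan_matrix (ys @ xs) :: 'a :: semiring_1 mat)"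
  unfolding jordan_matrix_append by (rule similar_mat_four_block_swap) auto

text \<open>Exchanging two consecutive segments suffices: if \<open>ys = as @ x # bs\<close>, moving
  \<open>as\<close> to the end brings \<open>x\<close> to the front, and the induction hypothesis
  treats the rest.\<close>

lemma similar_jordan_matrix_mset:
  assumes "mset xs = mset ys"
  shows "similar_mat (jordan_matrix xs) (jordan_matrix ys :: 'a :: semiring_1 mat)"
  using assms
proof (induction xs arbitrary: ys)
  case Nil
  then show ?case using similar_mat_refl[OF jordan_matrix_carrier] by simp
next
  case (Cons x xs)
  obtain as bs where ys: "ys = as @ x # bs"
    by (metis Cons.prems list.set_intros(1) set_mset_mset split_list)
  obtain n a where x: "x = (n, a)" by force
  have mset: "mset xs = mset (bs @ as)" using Cons.prems ys by simp
  have len: "sum_list (map fst xs) = sum_list (map fst (bs @ as))"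
    using arg_cong[OF mset, of "\<lambda>M. sum_mset (image_mset fst M)"]
    by (simp only: mset_map[symmetric] sum_mset_sum_list)
  have "similar_mat (jordan_matrix (x # xs)) (jordan_matrix (x # bs @ as))"
    unfolding x jordan_matrix_Cons len
    by (rule similar_mat_four_block_0_0[OF similar_mat_refl[OF jordan_block_carrier] Cons.IH[OF mset]])
      (auto simp: len[symmetric] simp del: map_append sum_list_append)
  moreover have "similar_mat (jordan_matrix (x # bs @ as)) (jordan_matrix ys)"
    using similar_jordan_matrix_append_commute[of "x # bs" as] unfolding ys by simp
  ultimately show ?case by (rule similar_mat_trans)
qed

text \<open>A multiset turns uniqueness of the Jordan form into an equation and its symmetries into
  statements about \<open>image_mset\<close>. Through \<open>jordan_nf\<close> all blocks have
  positive size.\<close>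

definition has_jordan_blocks :: "'a :: field mat \<Rightarrow> (nat \<times> 'a) multiset \<Rightarrow> bool" where
  "has_jordan_blocks A F \<longleftrightarrow> (\<exists>xs. mset xs = F \<and> jordan_nf A xs)"

lemma has_jordan_blocks_exists:
  fixes A :: "complex mat"
  assumes "A \<in> carrier_mat n n"
  obtains F where "has_jordan_blocks A F"
  using char_poly_factorized[OF assms] jordan_nf_exists[OF assms] that
  unfolding has_jordan_blocks_def by blast

lemma has_jordan_blocks_pos:
  "has_jordan_blocks A F \<Longrightarrow> (0, e) \<notin># F"
  unfolding has_jordan_blocks_def jordan_nf_def by force

lemma count_jordan_blocks:
  assumes "has_jordan_blocks A F" "k \<noteq> 0"
  shows "count F (k, e) = compute_nr_of_jordan_blocks A e k"
proof -
  obtain xs where "mset xs = F" "jordan_nf A xs"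
    using assms(1) unfolding has_jordan_blocks_def by blast
  then show ?thesis
    using compute_nr_of_jordan_blocks[of A xs k e] assms(2) by (auto simp: count_mset count_list_eq_length_filter)
qed

text \<open>The multiplicity of a block of positive size is computed from dimensions of generalized
  eigenspaces; blocks of size 0 do not occur.\<close>

lemma has_jordan_blocks_unique:
  assumes A: "has_jordan_blocks A F" and B: "has_jordan_blocks B G"
    and "dim_gen_eigenspace A = dim_gen_eigenspace B"
  shows "F = G"
proof (rule multiset_eqI)
  fix x :: "nat \<times> 'a"
  obtain k e where x: "x = (k, e)" by force
  show "count F x = count G x"
  proof (cases "k = 0")
    case True
    then show ?thesis
      using has_jordan_blocks_pos[OF A] has_jordan_blocks_pos[OF B] x by (simp add: not_in_iff)
  next
    case False
    then show ?thesis
      using count_jordan_blocks[OF A False] count_jordan_blocks[OF B False] assms(3)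
      by (simp add: x compute_nr_of_jordan_blocks_def)
  qed
qed

lemma has_jordan_blocks_imp_similar:
  assumes "has_jordan_blocks A F" "has_jordan_blocks B F"
  shows "similar_mat A B"
  using assms similar_mat_trans similar_mat_sym similar_jordan_matrix_mset
  unfolding has_jordan_blocks_def jordan_nf_def by metis

lemma has_jordan_blocks_dim:
  assumes "has_jordan_blocks A F" "A \<in> carrier_mat n n"
  shows "sum_mset (image_mset fst F) = n"
proof -
  obtain xs where "mset xs = F" "similar_mat A (jordan_matrix xs)"
    using assms(1) unfolding has_jordan_blocks_def jordan_nf_def by blast
  moreover from this(2) obtain m where "A \<in> carrier_mat m m" "jordan_matrix xs \<in> carrier_mat m m"
    using similar_matD by blast
  ultimately show ?thesis
    using assms(2) by (metis carrier_matD(1) jordan_matrix_dim(1) mset_map sum_mset_sum_list)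
qed

lemma has_jordan_blocks_jordan_matrix:
  assumes "0 \<notin> fst ` set xs"
  shows "has_jordan_blocks (jordan_matrix xs) (mset xs)"
  using assms similar_mat_refl[OF jordan_matrix_carrier]
  unfolding has_jordan_blocks_def jordan_nf_def by blast

lemma has_jordan_blocks_jordan_block:
  assumes "m \<noteq> 0"
  shows "has_jordan_blocks (jordan_block m e) {#(m, e)#}"
  using has_jordan_blocks_jordan_matrix[of "[(m, e)]"] assms
  unfolding jordan_matrix_def by (simp only: list.map prod.case diag_block_mat_singleton) simp

lemma has_jordan_blocks_four_block:
  assumes "has_jordan_blocks A F" "has_jordan_blocks B G"
    and A: "A \<in> carrier_mat n n" and B: "B \<in> carrier_mat m m"
  shows "has_jordan_blocks (four_block_mat A (0\<^sub>m n m) (0\<^sub>m m n) B) (F + G)"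
proof -
  obtain xs where xs: "mset xs = F" "0 \<notin> fst ` set xs" "similar_mat A (jordan_matrix xs)"
    using assms(1) unfolding has_jordan_blocks_def jordan_nf_def by blast
  obtain ys where ys: "mset ys = G" "0 \<notin> fst ` set ys" "similar_mat B (jordan_matrix ys)"
    using assms(2) unfolding has_jordan_blocks_def jordan_nf_def by blast
  have n: "sum_list (map fst xs) = n" and m: "sum_list (map fst ys) = m"
    using has_jordan_blocks_dim[OF assms(1) A] has_jordan_blocks_dim[OF assms(2) B] xs(1) ys(1)
    by (metis mset_map sum_mset_sum_list)+
  have "similar_mat (four_block_mat A (0\<^sub>m n m) (0\<^sub>m m n) B) (jordan_matrix (xs @ ys))"
    unfolding jordan_matrix_append n m by (rule similar_mat_four_block_0_0[OF xs(3) ys(3) A B])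
  then show ?thesis
    using xs ys unfolding has_jordan_blocks_def jordan_nf_def
    by (intro exI[of _ "xs @ ys"]) auto
qed

lemma count_image_mset_inj:
  assumes "inj f"
  shows "count (image_mset f M) (f x) = count M x"
  by (induction M) (auto simp: inj_eq[OF assms])

text \<open>The generalized eigenspaces of \<open>B\<close> at \<open>inverse e\<close> have the
  dimensions of those of \<open>A\<close> at \<open>e\<close>, and these dimensions determine the
  multiplicities.\<close>

lemma has_jordan_blocks_inverse:
  fixes A B :: "complex mat"
  assumes A: "A \<in> carrier_mat n n" and B: "B \<in> carrier_mat n n"
    and AB: "A * B = 1\<^sub>m n" and BA: "B * A = 1\<^sub>m n" and F: "has_jordan_blocks A F"
  shows "has_jordan_blocks B (image_mset (map_prod id inverse) F)"
proof -
  obtain G where G: "has_jordan_blocks B G" by (rule has_jordan_blocks_exists[OF B])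
  have "G = image_mset (map_prod id inverse) F"
  proof (rule multiset_eqI)
    fix x :: "nat \<times> complex"
    \<comment> \<open>With \<open>inverse 0 = 0\<close>, inversion is an involution on all complex
      numbers, so every eigenvalue has the form \<open>inverse e\<close>.\<close>
    obtain k e where x: "x = map_prod id inverse (k, e)"
      by (metis inverse_inverse_eq id_apply map_prod_simp surj_pair)
    have inj: "inj (map_prod id inverse :: nat \<times> complex \<Rightarrow> _)"
      by (auto simp: inj_def)
    have "count (image_mset (map_prod id inverse) F) x = count F (k, e)"
      unfolding x by (rule count_image_mset_inj[OF inj])
    also have "\<dots> = count G x"
    proof (cases "k = 0")
      case True
      then show ?thesis
        using has_jordan_blocks_pos[OF F] has_jordan_blocks_pos[OF G] x by (simp add: not_in_iff)
    next
      case False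
      then show ?thesis
        using count_jordan_blocks[OF F False] count_jordan_blocks[OF G False]
          dim_gen_eigenspace_inverse[OF A B AB BA]
        by (simp add: x compute_nr_of_jordan_blocks_def)
    qed
    finally show "count G x = count (image_mset (map_prod id inverse) F) x" ..
  qed
  with G show ?thesis by simp
qed

section \<open>Transport of similarity and Jordan matrices along entrywise homomorphisms\<close>

lemma (in semiring_hom) similar_mat_hom:
  assumes "similar_mat A B"
  shows "similar_mat (mat\<^sub>h A) (mat\<^sub>h B)"
proof -
  obtain n P Q where c: "A \<in> carrier_mat n n" "B \<in> carrier_mat n n" "P \<in> carrier_mat n n" "Q \<in> carrier_mat n n"
    and PQ: "P * Q = 1\<^sub>m n" "Q * P = 1\<^sub>m n" "A = P * B * Q"
    using similar_matD[OF assms] by blast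
  show ?thesis
  proof (rule similar_matI)
    show "{mat\<^sub>h A, mat\<^sub>h B, mat\<^sub>h P, mat\<^sub>h Q} \<subseteq> carrier_mat n n" using c by auto
    show "mat\<^sub>h P * mat\<^sub>h Q = 1\<^sub>m n" "mat\<^sub>h Q * mat\<^sub>h P = 1\<^sub>m n"
      using c PQ by (simp_all add: mat_hom_mult[symmetric] mat_hom_one)
    show "mat\<^sub>h A = mat\<^sub>h P * mat\<^sub>h B * mat\<^sub>h Q"
      using c PQ(3) mat_hom_mult[OF c(3,2)] mat_hom_mult[of "P * B" n n Q n] by simp
  qed
qed

lemma (in semiring_hom) map_jordan_matrix:
  "mat\<^sub>h (jordan_matrix xs) = jordan_matrix (map (map_prod id hom) xs)"
proof (induction xs)
  case Nil
  then show ?case by (auto simp: jordan_matrix_def)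
next
  case (Cons x xs)
  obtain n a where x: "x = (n, a)" by force
  have "mat\<^sub>h (jordan_block n a) = jordan_block n (hom a)"
    by (rule eq_matI) (auto simp: jordan_block_def)
  moreover have "sum_list (map fst (map (map_prod id hom) xs)) = sum_list (map fst xs)"
    by (simp add: comp_def)
  ultimately show ?case
    unfolding x list.map map_prod_simp id_apply jordan_matrix_Cons
    by (subst map_four_block_mat) (auto simp: map_four_block_mat[OF jordan_block_carrier] Cons.IH[unfolded id_def] simp del: map_map)
qed


interpretation cnj_hom: field_hom cnj
  by unfold_locales auto

lemma has_jordan_blocks_cnj:
  assumes "has_jordan_blocks A F"
  shows "has_jordan_blocks (map_mat cnj A) (image_mset (map_prod id cnj) F)"
proof -
  obtain xs where xs: "mset xs = F" "0 \<notin> fst ` set xs" "similar_mat A (jordan_matrix xs)"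
    using assms unfolding has_jordan_blocks_def jordan_nf_def by blast
  show ?thesis
    unfolding has_jordan_blocks_def jordan_nf_def
    using xs cnj_hom.similar_mat_hom[OF xs(3)]
    by (intro exI[of _ "map (map_prod id cnj) xs"]) (force simp: cnj_hom.map_jordan_matrix)
qed

section \<open>Kernels with a quaternionic structure\<close>

text \<open>The columns of \<open>B\<close> are a basis of the kernel. Coordinates are provided for
  matrices with any number of columns, so that the coefficient matrix of a map on the kernel is
  obtained in one application.\<close>

lemma mat_kernel_basis_matrix:
  fixes M :: "'a :: field mat"
  assumes M: "M \<in> carrier_mat nr nc"
  obtains B where "B \<in> carrier_mat nc (kernel_dim M)" "M * B = 0\<^sub>m nr (kernel_dim M)"
    "\<And>X m. X \<in> carrier_mat nc m \<Longrightarrow> M * X = 0\<^sub>m nr m \<Longrightarrow> \<exists>Y \<in> carrier_mat (kernel_dim M) m. X = B * Y"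
    "\<And>Y Z m. Y \<in> carrier_mat (kernel_dim M) m \<Longrightarrow> Z \<in> carrier_mat (kernel_dim M) m \<Longrightarrow>
       B * Y = B * Z \<Longrightarrow> Y = Z"
proof -
  interpret kernel nr nc M by unfold_locales (rule M)
  obtain S where fin: "finite S" and basis: "basis S"
    using kernel_basis_exists[OF M] by blast
  have indpt: "lin_indpt S" and gen: "span S = mat_kernel M" and S: "S \<subseteq> mat_kernel M"
    using basis unfolding Ker.basis_def by auto
  obtain vs where vs: "set vs = S" "distinct vs"
    using finite_distinct_list[OF fin] by blast
  have len: "length vs = kernel_dim M"
    using Ker.dim_basis[OF fin basis] vs distinct_card by fastforce
  define d where "d = kernel_dim M"
  have lend: "length vs = d" using len d_def by simp
  define B where "B = mat_of_cols nc vs"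
  have B: "B \<in> carrier_mat nc d" unfolding B_def using lend by auto
  have bij: "bij_betw ((!) vs) {..<d} S"
    using bij_betw_nth[OF vs(2), of "{..<d}" S] vs lend by simp
  have BY: "(B * Y) $$ (i, j) = (\<Sum>l<d. vs ! l $ i * Y $$ (l, j))"
    if "Y \<in> carrier_mat d m" "i < nc" "j < m" for Y i j m
    using that B lend unfolding B_def
    by (auto simp: scalar_prod_def mat_of_cols_index atLeast0LessThan intro!: sum.cong)
  have vs_ker: "vs ! l \<in> mat_kernel M" if "l < d" for l
    using that vs lend S by auto
  have "M * B = 0\<^sub>m nr d"
  proof (rule eq_matI)
    fix i j assume ij: "i < dim_row (0\<^sub>m nr d)" "j < dim_col (0\<^sub>m nr d :: 'a mat)"
    have v: "vs ! j \<in> carrier_vec nc" "M *\<^sub>v (vs ! j) = 0\<^sub>v nr"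
      using mat_kernelD[OF M vs_ker] ij by auto
    have "(M * B) $$ (i, j) = (M *\<^sub>v (vs ! j)) $ i"
      using M B ij v(1) lend unfolding B_def by (auto simp: col_mat_of_cols)
    also have "\<dots> = 0\<^sub>m nr d $$ (i, j)" unfolding v(2) using ij by simp
    finally show "(M * B) $$ (i, j) = 0\<^sub>m nr d $$ (i, j)" .
  qed (use M B in auto)
  moreover have "\<exists>Y \<in> carrier_mat d m. X = B * Y"
    if X: "X \<in> carrier_mat nc m" and MX: "M * X = 0\<^sub>m nr m" for X m
  proof -
    have "\<exists>a. \<forall>i<nc. X $$ (i, j) = (\<Sum>x\<in>S. a x * x $ i)" if j: "j < m" for j
    proof -
      have "M *\<^sub>v col X j = col (M * X) j"
        using M X j by (intro eq_vecI) auto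
      also have "\<dots> = 0\<^sub>v nr" using MX j by simp
      finally have "col X j \<in> mat_kernel M"
        using X j by (intro mat_kernelI[OF M]) (auto simp: col_def)
      then have "col X j \<in> span S" using gen by simp
      then obtain a where a: "lincomb a S = col X j"
        using Ker.finite_in_span[OF fin] S by auto
      have "X $$ (i, j) = (\<Sum>x\<in>S. a x * x $ i)" if "i < nc" for i
        using lincomb_index[OF that S, of a] a X j that by simp
      then show ?thesis by blast
    qed
    then obtain a where a: "\<And>j i. j < m \<Longrightarrow> i < nc \<Longrightarrow> X $$ (i, j) = (\<Sum>x\<in>S. a j x * x $ i)"
      by metis
    define Y where "Y = mat d m (\<lambda>(l, j). a j (vs ! l))"
    have Y: "Y \<in> carrier_mat d m" unfolding Y_def by simp
    have "X = B * Y"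
    proof (rule eq_matI)
      fix i j assume "i < dim_row (B * Y)" "j < dim_col (B * Y)"
      then have ij: "i < nc" "j < m" using B Y by auto
      have "X $$ (i, j) = (\<Sum>l<d. a j (vs ! l) * vs ! l $ i)"
        unfolding a[OF ij(2,1)] by (rule sum.reindex_bij_betw[OF bij, symmetric])
      then show "X $$ (i, j) = (B * Y) $$ (i, j)"
        unfolding BY[OF Y ij] using ij by (simp add: Y_def mult.commute)
    qed (use X B Y in auto)
    with Y show ?thesis by blast
  qed
  moreover have "Y = Z"
    if Y: "Y \<in> carrier_mat d m" and Z: "Z \<in> carrier_mat d m" and eq: "B * Y = B * Z" for Y Z m
  proof (rule eq_matI)
    fix l j assume "l < dim_row Z" "j < dim_col Z"
    then have lj: "l < d" "j < m" using Z by auto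
    \<comment> \<open>Column \<open>j\<close> of \<open>Y - Z\<close>, turned into a coefficient
      function on basis vectors; \<open>inv_into\<close> recovers the position of a vector in
      \<open>vs\<close>.\<close>
    define a where "a x = (Y - Z) $$ (inv_into {..<d} ((!) vs) x, j)" for x
    have a: "a (vs ! i) = Y $$ (i, j) - Z $$ (i, j)" if "i < d" for i
      unfolding a_def using bij_betw_inv_into_left[OF bij, of i] that lj Y Z by simp
    have "lincomb a S = 0\<^sub>v nc"
    proof (rule eq_vecI)
      fix i assume "i < dim_vec (0\<^sub>v nc :: 'a vec)"
      then have i: "i < nc" by simp
      have "lincomb a S $ i = (\<Sum>l<d. a (vs ! l) * vs ! l $ i)"
        unfolding lincomb_index[OF i S] by (rule sum.reindex_bij_betw[OF bij, symmetric])
      also have "\<dots> = (B * Y) $$ (i, j) - (B * Z) $$ (i, j)"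
        unfolding BY[OF Y i lj(2)] BY[OF Z i lj(2)] sum_subtractf[symmetric]
        by (rule sum.cong) (auto simp: a algebra_simps)
      finally show "lincomb a S $ i = 0\<^sub>v nc $ i" using eq i by simp
    qed (use lincomb_same[OF S] NC.lincomb_dim[OF fin] S mat_kernel_carrier[OF M] in auto)
    then have "a (vs ! l) = 0"
      using indpt fin S lj(1) vs lend unfolding Ker.lin_dep_def by auto
    then show "Y $$ (l, j) = Z $$ (l, j)" using a[OF lj(1)] by simp
  qed (use Y Z in auto)
  ultimately show ?thesis using that[of B] B unfolding d_def by blast
qed

text \<open>With \<open>*\<close> for entrywise conjugation, the antilinear map \<open>v \<mapsto> J v\<^sup>*\<close> restricts to a quaternionic structure on the kernel of \<open>M\<close>;
  in a basis it is given by some \<open>K\<close> with \<open>K K\<^sup>* = -1\<close>, and taking determinants forces even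
  dimension.\<close>

lemma even_kernel_dim_quaternionic_structure:
  fixes M J :: "complex mat"
  assumes M: "M \<in> carrier_mat N N" and J: "J \<in> carrier_mat N N"
    and MJ: "M * J = J * map_mat cnj M" and JJ: "J * map_mat cnj J = - 1\<^sub>m N"
  shows "even (kernel_dim M)"
proof -
  let ?d = "kernel_dim M"
  let ?c = "map_mat cnj"
  obtain B where B: "B \<in> carrier_mat N ?d" and MB: "M * B = 0\<^sub>m N ?d"
    and span: "\<And>X m. X \<in> carrier_mat N m \<Longrightarrow> M * X = 0\<^sub>m N m \<Longrightarrow> \<exists>Y \<in> carrier_mat ?d m. X = B * Y"
    and inj: "\<And>Y Z m. Y \<in> carrier_mat ?d m \<Longrightarrow> Z \<in> carrier_mat ?d m \<Longrightarrow> B * Y = B * Z \<Longrightarrow> Y = Z"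
    using mat_kernel_basis_matrix[OF M] by metis
  note [simp] = J M B
  have cM: "?c M \<in> carrier_mat N N" and cB: "?c B \<in> carrier_mat N ?d" and cJ: "?c J \<in> carrier_mat N N"
    by simp_all
  have "M * (J * ?c B) = J * (?c M * ?c B)"
    using assoc_mult_mat[OF M J cB] assoc_mult_mat[OF J cM cB] MJ by simp
  also have "?c M * ?c B = 0\<^sub>m N ?d"
    unfolding cnj_hom.mat_hom_mult[OF M B, symmetric] MB by (auto intro!: eq_matI)
  finally have "M * (J * ?c B) = 0\<^sub>m N ?d" using right_mult_zero_mat[OF J] by simp
  then obtain K where K: "K \<in> carrier_mat ?d ?d" and JB: "J * ?c B = B * K"
    using span[OF mult_carrier_mat[OF J cB]] by blast
  have cK: "?c K \<in> carrier_mat ?d ?d" using K by simp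
  \<comment> \<open>In coordinates the square of the antilinear map is \<open>K * ?c K\<close>.
    Computed through \<open>B\<close> it is -1, and injectivity of \<open>B\<close> removes
    \<open>B\<close>.\<close>
  have "B * (K * ?c K) = J * ?c B * ?c K"
    using assoc_mult_mat[OF B K cK] JB by simp
  also have "\<dots> = J * ?c (B * K)"
    using assoc_mult_mat[OF J cB cK] cnj_hom.mat_hom_mult[OF B K] by simp
  also have "\<dots> = J * ?c (J * ?c B)" by (simp add: JB)
  also have "?c (J * ?c B) = ?c J * B"
  proof -
    have "?c (?c B) = B" by (rule eq_matI) auto
    then show ?thesis using cnj_hom.mat_hom_mult[OF J cB] by simp
  qed
  also have "J * (?c J * B) = - 1\<^sub>m N * B"
    using assoc_mult_mat[OF J cJ B] JJ by simp
  also have "\<dots> = B * (- 1\<^sub>m ?d)"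
    using carrier_matD[OF B] by simp
  finally have "K * ?c K = - 1\<^sub>m ?d"
    using inj[of "K * ?c K" ?d "- 1\<^sub>m ?d"] K cK by auto
  then have "Determinant.det (K * ?c K) = Determinant.det ((- 1) \<cdot>\<^sub>m 1\<^sub>m ?d :: complex mat)"
    by (simp add: uminus_mat_def smult_mat_def map_mat_def) 
  then have "Determinant.det K * cnj (Determinant.det K) = (- 1) ^ ?d"
    using det_mult[OF K cK] cnj_hom.hom_det[of K] by (simp add: Determinant.det_smult)
  then have "complex_of_real ((cmod (Determinant.det K))\<^sup>2) = complex_of_real ((- 1) ^ ?d)"
    by (simp only: complex_norm_square) simp
  then have "(cmod (Determinant.det K))\<^sup>2 = (- 1) ^ ?d"
    using of_real_eq_iff by blast
  then have "(- 1 :: real) ^ ?d \<ge> 0"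
    by (metis zero_le_power2)
  then show ?thesis
    by (cases "even ?d") auto
qed

section \<open>Strong reversibility of matrices\<close>

text \<open>\<open>Y\<close> is the inverse of \<open>X\<close>. Only matrix equations occur, so the
  notion passes through direct sums and entrywise homomorphisms without reference to a unit
  group.\<close>

definition mat_strongly_reversible :: "nat \<Rightarrow> 'a :: semiring_1 mat \<Rightarrow> bool" where
  "mat_strongly_reversible n X \<longleftrightarrow> X \<in> carrier_mat n n \<and>
     (\<exists>Y \<in> carrier_mat n n. \<exists>H \<in> carrier_mat n n.
        X * Y = 1\<^sub>m n \<and> Y * X = 1\<^sub>m n \<and> H * H = 1\<^sub>m n \<and> H * X = Y * H)"

lemma mult_four_block_diag_mat:
  fixes A B C D :: "'a :: semiring_1 mat"
  assumes "A \<in> carrier_mat n n" "B \<in> carrier_mat m m" "C \<in> carrier_mat n n" "D \<in> carrier_mat m m"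
  shows "four_block_mat A (0\<^sub>m n m) (0\<^sub>m m n) B * four_block_mat C (0\<^sub>m n m) (0\<^sub>m m n) D
    = four_block_mat (A * C) (0\<^sub>m n m) (0\<^sub>m m n) (B * D)"
  using assms by (subst mult_four_block_mat[of _ n n _ m _ m _ _ n _ m]) auto

lemma mat_strongly_reversible_four_block:
  assumes "mat_strongly_reversible n A" "mat_strongly_reversible m B"
  shows "mat_strongly_reversible (n + m) (four_block_mat A (0\<^sub>m n m) (0\<^sub>m m n) B)"
proof -
  obtain Y H where A: "A \<in> carrier_mat n n" "Y \<in> carrier_mat n n" "H \<in> carrier_mat n n"
    "A * Y = 1\<^sub>m n" "Y * A = 1\<^sub>m n" "H * H = 1\<^sub>m n" "H * A = Y * H"
    using assms(1) unfolding mat_strongly_reversible_def by blast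
  obtain Z K where B: "B \<in> carrier_mat m m" "Z \<in> carrier_mat m m" "K \<in> carrier_mat m m"
    "B * Z = 1\<^sub>m m" "Z * B = 1\<^sub>m m" "K * K = 1\<^sub>m m" "K * B = Z * K"
    using assms(2) unfolding mat_strongly_reversible_def by blast
  show ?thesis
    unfolding mat_strongly_reversible_def
    using A B
    by (intro conjI bexI[of _ "four_block_mat Y (0\<^sub>m n m) (0\<^sub>m m n) Z"]
        bexI[of _ "four_block_mat H (0\<^sub>m n m) (0\<^sub>m m n) K"])
      (simp_all add: mult_four_block_diag_mat four_block_carrier_mat)
qed

text \<open>The inverse of the direct sum of \<open>A\<close> and \<open>B\<close> is that of
  \<open>B\<close> and \<open>A\<close>, and the involution \<open>?H\<close> exchanges the
  summands.\<close>

lemma mat_strongly_reversible_inverse_pair: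
  fixes A B :: "'a :: semiring_1 mat"
  assumes A: "A \<in> carrier_mat n n" and B: "B \<in> carrier_mat n n"
    and AB: "A * B = 1\<^sub>m n" and BA: "B * A = 1\<^sub>m n"
  shows "mat_strongly_reversible (n + n) (four_block_mat A (0\<^sub>m n n) (0\<^sub>m n n) B)"
proof -
  let ?H = "four_block_mat (0\<^sub>m n n) (1\<^sub>m n) (1\<^sub>m n) (0\<^sub>m n n) :: 'a mat"
  let ?X = "four_block_mat A (0\<^sub>m n n) (0\<^sub>m n n) B"
  let ?Y = "four_block_mat B (0\<^sub>m n n) (0\<^sub>m n n) A"
  have "?H * ?H = 1\<^sub>m (n + n)"
    by (subst mult_four_block_mat[of _ n n _ n _ n _ _ n _ n]) auto
  moreover have "?H * ?X = ?Y * ?H"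
    using A B by (simp add: mult_four_block_mat[of _ n n _ n _ n _ _ n _ n])
  moreover have "?H \<in> carrier_mat (n + n) (n + n)"
    by (rule four_block_carrier_mat) auto
  ultimately show ?thesis
    unfolding mat_strongly_reversible_def
    using assms
    by (intro conjI bexI[of _ ?Y] bexI[of _ ?H])
      (simp_all add: mult_four_block_diag_mat four_block_carrier_mat)
qed

lemma mat_strongly_reversible_similar:
  assumes "mat_strongly_reversible n A" "similar_mat B A"
  shows "mat_strongly_reversible n B"
proof -
  obtain Y H where A: "A \<in> carrier_mat n n" "Y \<in> carrier_mat n n" "H \<in> carrier_mat n n"
    "A * Y = 1\<^sub>m n" "Y * A = 1\<^sub>m n" "H * H = 1\<^sub>m n" "H * A = Y * H"
    using assms(1) unfolding mat_strongly_reversible_def by blast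
  obtain m P Q where "{B, A, P, Q} \<subseteq> carrier_mat m m" "P * Q = 1\<^sub>m m" "Q * P = 1\<^sub>m m" "B = P * A * Q"
    using similar_matD[OF assms(2)] by blast
  moreover from this A(1) have "m = n" by auto
  ultimately have P: "P \<in> carrier_mat n n" "Q \<in> carrier_mat n n" "P * Q = 1\<^sub>m n" "Q * P = 1\<^sub>m n"
    and B: "B = P * A * Q" by auto
  have conj: "(P * V * Q) * (P * W * Q) = P * (V * W) * Q"
    if V: "V \<in> carrier_mat n n" and W: "W \<in> carrier_mat n n" for V W
  proof -
    have "(P * V * Q) * (P * W * Q) = P * V * (Q * P) * W * Q"
      using P(1,2) V W by (simp add: assoc_mult_mat[of _ n n _ n _ n])
    also have "\<dots> = P * (V * W) * Q"
      using P V W by (simp add: assoc_mult_mat[of _ n n _ n _ n])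
    finally show ?thesis .
  qed
  have one: "P * 1\<^sub>m n * Q = 1\<^sub>m n" using P by simp
  show ?thesis
    unfolding mat_strongly_reversible_def B
  proof (rule conjI, use A P in simp, rule bexI[of _ "P * Y * Q"], rule bexI[of _ "P * H * Q"], intro conjI)
    show "P * A * Q * (P * Y * Q) = 1\<^sub>m n" "P * Y * Q * (P * A * Q) = 1\<^sub>m n"
      "P * H * Q * (P * H * Q) = 1\<^sub>m n" "P * H * Q * (P * A * Q) = P * Y * Q * (P * H * Q)"
      using A by (simp_all only: conj one)
  qed (use A P in auto)
qed

lemma (in semiring_hom) mat_strongly_reversible_hom:
  assumes "mat_strongly_reversible n A"
  shows "mat_strongly_reversible n (mat\<^sub>h A)"
proof -
  obtain Y H where A: "A \<in> carrier_mat n n" "Y \<in> carrier_mat n n" "H \<in> carrier_mat n n"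
    "A * Y = 1\<^sub>m n" "Y * A = 1\<^sub>m n" "H * H = 1\<^sub>m n" "H * A = Y * H"
    using assms(1) unfolding mat_strongly_reversible_def by blast
  then show ?thesis
    unfolding mat_strongly_reversible_def
    by (intro conjI bexI[of _ "mat\<^sub>h Y"] bexI[of _ "mat\<^sub>h H"])
      (simp_all add: mat_hom_mult[symmetric, of _ n n _ n] mat_hom_one)
qed

lemma upper_triangular_mat_inverse:
  fixes A :: "'a :: field mat"
  assumes A: "A \<in> carrier_mat n n" and "upper_triangular A" and "\<And>i. i < n \<Longrightarrow> A $$ (i, i) \<noteq> 0"
  obtains B where "B \<in> carrier_mat n n" "A * B = 1\<^sub>m n" "B * A = 1\<^sub>m n"
proof -
  have "Determinant.det A = prod_list (diag_mat A)"
    by (rule det_upper_triangular[OF assms(2) A])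
  also have "\<dots> \<noteq> 0"
    using assms by (auto simp: prod_list_zero_iff diag_mat_def)
  finally have "A \<in> Units (ring_mat TYPE('a) n ())"
    by (rule det_non_zero_imp_unit[OF A])
  then show ?thesis
    using that by (auto simp: Units_def ring_mat_simps)
qed

text \<open>Multiply \<open>A * X = X * B\<close> by \<open>A'\<close> on the left and by
  \<open>B'\<close> on the right. For \<open>A = B\<close> this says that a matrix commuting with
  \<open>A\<close> commutes with its inverse.\<close>

lemma intertwining_inverse:
  fixes A B A' B' X :: "'a :: semiring_1 mat"
  assumes A: "A \<in> carrier_mat n n" and B: "B \<in> carrier_mat n n" and X: "X \<in> carrier_mat n n"
    and A': "A' \<in> carrier_mat n n" and B': "B' \<in> carrier_mat n n"
    and AA: "A' * A = 1\<^sub>m n" and BB: "B * B' = 1\<^sub>m n" and AX: "A * X = X * B"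
  shows "A' * X = X * B'"
proof -
  have "A' * X = A' * X * (B * B')" using A' X BB by simp
  also have "\<dots> = A' * (X * B) * B'"
    using assoc_mult_mat[OF A' X mult_carrier_mat[OF B B']] assoc_mult_mat[OF A' mult_carrier_mat[OF X B] B']
      assoc_mult_mat[OF X B B'] by simp
  also have "\<dots> = A' * (A * X) * B'" by (simp only: AX)
  also have "\<dots> = A' * A * X * B'" using assoc_mult_mat[OF A' A X] by simp
  also have "\<dots> = X * B'" using X AA by simp
  finally show ?thesis .
qed

text \<open>The dimensions at \<open>e\<close> alone force one block of size \<open>m\<close>, which
  already exhausts the size of the matrix.\<close>

lemma has_jordan_blocks_single:
  fixes A :: "complex mat"
  assumes A: "A \<in> carrier_mat m m" and m: "m \<noteq> 0"
    and dim: "\<And>k. dim_gen_eigenspace A e k = dim_gen_eigenspace (jordan_block m e) e k"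
  shows "has_jordan_blocks A {#(m, e)#}"
proof -
  obtain F where F: "has_jordan_blocks A F" by (rule has_jordan_blocks_exists[OF A])
  have "count F (m, e) = count {#(m, e)#} (m, e)"
    using count_jordan_blocks[OF F m, of e] count_jordan_blocks[OF has_jordan_blocks_jordan_block[OF m] m, of e e] dim
    by (simp add: compute_nr_of_jordan_blocks_def)
  then have "(m, e) \<in># F" by (simp add: count_greater_zero_iff[symmetric] del: count_greater_zero_iff)
  then obtain G where G: "F = add_mset (m, e) G" by (metis insert_DiffM)
  then have "sum_mset (image_mset fst G) = 0"
    using has_jordan_blocks_dim[OF F A] by simp
  then have "\<forall>x \<in># G. fst x = 0" by simp
  moreover have "\<forall>x \<in># G. fst x \<noteq> 0"
    using has_jordan_blocks_pos[OF F] unfolding G by (metis prod.collapse union_iff add_mset_add_single)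
  ultimately have "G = {#}" by (metis multiset_nonemptyE)
  then show ?thesis using F G by simp
qed

text \<open>The Cayley transform \<open>e (1 + N/2) (1 - N/2)\<^sup>-\<^sup>1\<close> of the nilpotent block \<open>N\<close>, where \<open>e\<^sup>2 = 1\<close>, is
  conjugated to its inverse by any involution anticommuting with \<open>N\<close>.\<close>

lemma strongly_reversible_single_jordan_block:
  fixes e :: complex
  assumes m: "m \<noteq> 0" and e: "e * e = 1"
  obtains X where "mat_strongly_reversible m X" "has_jordan_blocks X {#(m, e)#}"
proof -
  define N where "N = (jordan_block m 0 :: complex mat)"
  define S where "S = mat m m (\<lambda>(i, j). if i = j then (- 1) ^ i else 0 :: complex)"
  define D where "D = 1\<^sub>m m + (- (1/2)) \<cdot>\<^sub>m N"
  define E where "E = 1\<^sub>m m + (1/2) \<cdot>\<^sub>m N"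
  have N: "N \<in> carrier_mat m m" and S: "S \<in> carrier_mat m m"
    and D: "D \<in> carrier_mat m m" and E: "E \<in> carrier_mat m m"
    unfolding N_def S_def D_def E_def by auto
  obtain D' where D': "D' \<in> carrier_mat m m" "D * D' = 1\<^sub>m m" "D' * D = 1\<^sub>m m"
    by (rule upper_triangular_mat_inverse[OF D])
      (auto simp: D_def N_def jordan_block_def upper_triangular_def)
  obtain E' where E': "E' \<in> carrier_mat m m" "E * E' = 1\<^sub>m m" "E' * E = 1\<^sub>m m"
    by (rule upper_triangular_mat_inverse[OF E])
      (auto simp: E_def N_def jordan_block_def upper_triangular_def)
  have SS: "S * S = 1\<^sub>m m"
    unfolding S_def
    by (rule eq_matI) (auto simp: scalar_prod_def sum.delta power_add[symmetric] if_distrib[of "\<lambda>x. x * _"] if_distrib[of "\<lambda>x. _ * x"] cong: if_cong)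
  have Smul: "(S * X) $$ (i, j) = (- 1) ^ i * X $$ (i, j)" "(X * S) $$ (i, j) = (- 1) ^ j * X $$ (i, j)"
    if "X \<in> carrier_mat m m" "i < m" "j < m" for X i j
    using that unfolding S_def
    by (auto simp: scalar_prod_def sum.delta if_distrib[of "\<lambda>x. x * _"] if_distrib[of "\<lambda>x. _ * x"] cong: if_cong)
  \<comment> \<open>\<open>S\<close> anticommutes with \<open>N\<close>, since the superdiagonal of
    \<open>N\<close> joins indices of opposite parity; hence conjugation by \<open>S\<close>
    exchanges 1 + N/2 and 1 - N/2.\<close>
  have SE: "S * E = D * S"
    using S D E by (intro eq_matI) (auto simp: Smul simp del: index_mult_mat(1), auto simp: D_def E_def N_def jordan_block_def)
  have SD: "S * D = E * S"
    using S D E by (intro eq_matI) (auto simp: Smul simp del: index_mult_mat(1), auto simp: D_def E_def N_def jordan_block_def)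
  have SD': "E' * S = S * D'"
    by (rule intertwining_inverse[OF E D S E'(1) D'(1) E'(3) D'(2) SD[symmetric]])
  define X where "X = e \<cdot>\<^sub>m (E * D')"
  define Y where "Y = e \<cdot>\<^sub>m (D * E')"
  have X: "X \<in> carrier_mat m m" and Y: "Y \<in> carrier_mat m m"
    unfolding X_def Y_def using D E D' E' by auto
  have mul: "(e \<cdot>\<^sub>m V) * (e \<cdot>\<^sub>m W) = V * W" if "V \<in> carrier_mat m m" "W \<in> carrier_mat m m" for V W
    using that e by (simp add: mult_smult_distrib[of _ m m _ m] mult_smult_assoc_mat[of _ m m _ m])
      (auto intro!: eq_matI simp: mult.assoc[symmetric])
  have assoc4: "A * B * (A' * B') = A * (B * A') * B'"
    if "A \<in> carrier_mat m m" "B \<in> carrier_mat m m" "A' \<in> carrier_mat m m" "B' \<in> carrier_mat m m"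
    for A B A' B' :: "complex mat"
    using that by (simp add: assoc_mult_mat[of _ m m _ m _ m])
  have "E * D' * (D * E') = E * (D' * D) * E'" "D * E' * (E * D') = D * (E' * E) * D'"
    using D E D'(1) E'(1) by (simp_all only: assoc4)
  then have XY: "X * Y = 1\<^sub>m m" "Y * X = 1\<^sub>m m"
    unfolding X_def Y_def using D E D' E' by (simp_all add: mul)
  have "S * (E * D') = D * (S * D')" "D * (E' * S) = D * E' * S"
    using assoc_mult_mat[OF S E D'(1)] assoc_mult_mat[OF D S D'(1)] assoc_mult_mat[OF D E'(1) S] SE by simp_all
  then have "S * X = Y * S"
    unfolding X_def Y_def using S D E D'(1) E'(1) SD'
    by (simp add: mult_smult_distrib[of _ m m _ m] mult_smult_assoc_mat[of _ m m _ m])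
  then have "mat_strongly_reversible m X"
    unfolding mat_strongly_reversible_def using X Y S XY SS by blast
  moreover have "has_jordan_blocks X {#(m, e)#}"
  proof (rule has_jordan_blocks_single[OF X m])
    fix k
    let ?U = "e \<cdot>\<^sub>m D'" and ?W = "e \<cdot>\<^sub>m D"
    have "D * N = N * D"
      unfolding D_def using N mult_add_distrib_mat[OF N one_carrier_mat, of "(- (1/2)) \<cdot>\<^sub>m N"]
        add_mult_distrib_mat[OF one_carrier_mat _ N, of "(- (1/2)) \<cdot>\<^sub>m N"]
      by (simp add: mult_smult_distrib[of _ m m _ m] mult_smult_assoc_mat[of _ m m _ m])
    from intertwining_inverse[OF D D N D'(1) D'(1) D'(3) D'(2) this]
    have ND: "N * D' = D' * N" ..
    \<comment> \<open>This gives X - e = (e D') N, an invertible matrix times \<open>N\<close> that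
      commutes with \<open>N\<close>, so the powers of X - e and of \<open>N\<close> have the same
      kernel dimensions.\<close>
    have "E = D + N" unfolding E_def D_def N_def by (rule eq_matI) auto
    then have "E * D' = 1\<^sub>m m + D' * N"
      using add_mult_distrib_mat[OF D N D'(1)] D'(2) ND by simp
    then have "char_matrix X e = ?U * N"
      unfolding X_def char_matrix_def using N D'(1)
      by (simp add: mult_smult_assoc_mat[of _ m m _ m]) (auto intro!: eq_matI simp: algebra_simps)
    moreover have "kernel_dim ((?U * N) ^\<^sub>m k) = kernel_dim (N ^\<^sub>m k)"
    proof (rule kernel_dim_unit_mult_pow[of _ m _ ?W])
      show "?U * N = N * ?U"
        using N D'(1) ND by (simp add: mult_smult_distrib[of _ m m _ m] mult_smult_assoc_mat[of _ m m _ m])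
    qed (use N D D' in \<open>auto simp: mul\<close>)
    ultimately show "dim_gen_eigenspace X e k = dim_gen_eigenspace (jordan_block m e) e k"
      unfolding dim_gen_eigenspace_def char_matrix_jordan_block N_def by simp
  qed
  ultimately show ?thesis by (rule that)
qed

section \<open>The complex representation of quaternionic matrices\<close>

text \<open>A quaternion is z + w j with complex z = \<open>quat_fst q\<close> and w =
  \<open>quat_snd q\<close>. The product rules below express j z = \<open>cnj z\<close> j and j^2 =
  -1.\<close>

definition quat_fst :: "quat \<Rightarrow> complex" where
  "quat_fst q = Complex (qRe q) (qIm1 q)"

definition quat_snd :: "quat \<Rightarrow> complex" where
  "quat_snd q = Complex (qIm2 q) (qIm3 q)"

lemma quat_eq_complex_iff: "p = q \<longleftrightarrow> quat_fst p = quat_fst q \<and> quat_snd p = quat_snd q"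
  by (auto simp: quat_fst_def quat_snd_def quat_eq_iff)

lemma quat_fst_simps [simp]:
  "quat_fst 0 = 0" "quat_fst 1 = 1" "quat_fst (p + q) = quat_fst p + quat_fst q"
  "quat_fst (p * q) = quat_fst p * quat_fst q - quat_snd p * cnj (quat_snd q)"
  "quat_fst (quat_of_complex z) = z"
  by (auto simp: quat_fst_def quat_snd_def quat_arith_defs quat_of_complex_def complex_eq_iff)

lemma quat_snd_simps [simp]:
  "quat_snd 0 = 0" "quat_snd 1 = 0" "quat_snd (p + q) = quat_snd p + quat_snd q"
  "quat_snd (p * q) = quat_fst p * quat_snd q + quat_snd p * cnj (quat_fst q)"
  "quat_snd (quat_of_complex z) = 0"
  by (auto simp: quat_fst_def quat_snd_def quat_arith_defs quat_of_complex_def complex_eq_iff)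

lemma quat_fst_sum: "quat_fst (sum f I) = (\<Sum>i\<in>I. quat_fst (f i))"
  by (induction I rule: infinite_finite_induct) auto

lemma quat_snd_sum: "quat_snd (sum f I) = (\<Sum>i\<in>I. quat_snd (f i))"
  by (induction I rule: infinite_finite_induct) auto

lemma quat_fst_snd_surj: "\<exists>q. quat_fst q = z \<and> quat_snd q = w"
  by (intro exI[of _ "Quat (Re z) (Im z) (Re w) (Im w)"]) (simp add: quat_fst_def quat_snd_def)

interpretation quat_of_complex_hom: semiring_hom quat_of_complex
  by unfold_locales (auto simp: quat_eq_complex_iff)

text \<open>The map \<chi> of the overview. The upper blocks are the components of \<open>A\<close>,
  the lower ones those of j \<open>A\<close>.\<close>

definition complex_rep :: "quat mat \<Rightarrow> complex mat" where
  "complex_rep A = four_block_mat (map_mat quat_fst A) (map_mat quat_snd A)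
     (map_mat (\<lambda>q. - cnj (quat_snd q)) A) (map_mat (\<lambda>q. cnj (quat_fst q)) A)"

lemma complex_rep_carrier [simp]:
  "A \<in> carrier_mat n n \<Longrightarrow> complex_rep A \<in> carrier_mat (n + n) (n + n)"
  unfolding complex_rep_def by (rule four_block_carrier_mat) auto

lemma complex_rep_mult:
  assumes A: "A \<in> carrier_mat n n" and B: "B \<in> carrier_mat n n"
  shows "complex_rep (A * B) = complex_rep A * complex_rep B"
proof -
  have e: "(X * Y) $$ (i, j) = (\<Sum>k<n. X $$ (i, k) * Y $$ (k, j))"
    if "X \<in> carrier_mat n n" "Y \<in> carrier_mat n n" "i < n" "j < n" for X Y :: "'b :: semiring_1 mat" and i j
    using that by (auto simp: scalar_prod_def atLeast0LessThan intro!: sum.cong)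
  show ?thesis
    unfolding complex_rep_def
  proof (subst mult_four_block_mat[of _ n n _ n _ n _ _ n _ n], goal_cases)
    \<comment> \<open>Case 9 compares the four blocks of the product; the remaining goals are
      carrier conditions.\<close>
    case 9
    show ?case
      by (intro cong_four_block_mat; intro eq_matI)
        (use A B in \<open>simp_all add: e quat_fst_sum quat_snd_sum sum.distrib sum_subtractf sum_negf
          del: index_mult_mat(1)\<close>)
  qed (use A B in auto)
qed

lemma complex_rep_one: "complex_rep (1\<^sub>m n) = 1\<^sub>m (n + n)"
  unfolding complex_rep_def four_block_one_mat[symmetric]
  by (intro cong_four_block_mat) (auto intro!: eq_matI)

lemma complex_rep_inj:
  assumes A: "A \<in> carrier_mat n n" and B: "B \<in> carrier_mat n n" and eq: "complex_rep A = complex_rep B"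
  shows "A = B"
proof (rule eq_matI)
  fix i j assume "i < dim_row B" "j < dim_col B"
  then have ij: "i < n" "j < n" using B by auto
  have "complex_rep A $$ (i, j) = complex_rep B $$ (i, j)"
    "complex_rep A $$ (i, j + n) = complex_rep B $$ (i, j + n)"
    using eq by simp_all
  then show "A $$ (i, j) = B $$ (i, j)"
    using A B ij by (simp add: complex_rep_def quat_eq_complex_iff)
qed (use A B in auto)

lemma complex_rep_of_complex:
  assumes "X \<in> carrier_mat n n"
  shows "complex_rep (map_mat quat_of_complex X)
    = four_block_mat X (0\<^sub>m n n) (0\<^sub>m n n) (map_mat cnj X)"
  unfolding complex_rep_def
  by (intro cong_four_block_mat) (use assms in \<open>auto intro!: eq_matI\<close>)

text \<open>With J this matrix, the antilinear map sending v to J times the conjugate of v is the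
  quaternionic structure. The image of \<chi> consists of the matrices commuting with it, which is
  the equation \<open>X * quat_struct n = quat_struct n * map_mat cnj X\<close>.\<close>

definition quat_struct :: "nat \<Rightarrow> complex mat" where
  "quat_struct n = four_block_mat (0\<^sub>m n n) (1\<^sub>m n) (- 1\<^sub>m n) (0\<^sub>m n n)"

lemma quat_struct_carrier [simp]: "quat_struct n \<in> carrier_mat (n + n) (n + n)"
  unfolding quat_struct_def by (rule four_block_carrier_mat) auto

lemma cnj_quat_struct: "map_mat cnj (quat_struct n) = quat_struct n"
  unfolding quat_struct_def by (rule eq_matI) auto

lemma quat_struct_mult:
  assumes "X1 \<in> carrier_mat n n" "X2 \<in> carrier_mat n n" "X3 \<in> carrier_mat n n" "X4 \<in> carrier_mat n n"
  shows "quat_struct n * four_block_mat X1 X2 X3 X4 = four_block_mat X3 X4 (- X1) (- X2)"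
  unfolding quat_struct_def
  by (subst mult_four_block_mat[of _ n n _ n _ n _ _ n _ n]) (use assms in \<open>auto simp: carrier_matD\<close>)

lemma mult_quat_struct:
  assumes "X1 \<in> carrier_mat n n" "X2 \<in> carrier_mat n n" "X3 \<in> carrier_mat n n" "X4 \<in> carrier_mat n n"
  shows "four_block_mat X1 X2 X3 X4 * quat_struct n = four_block_mat (- X2) X1 (- X4) X3"
  unfolding quat_struct_def
  by (subst mult_four_block_mat[of _ n n _ n _ n _ _ n _ n]) (use assms in \<open>auto simp: carrier_matD\<close>)

lemma quat_struct_square: "quat_struct n * quat_struct n = - 1\<^sub>m (n + n)"
proof -
  have "quat_struct n * quat_struct n = four_block_mat (- 1\<^sub>m n) (0\<^sub>m n n) (- (0\<^sub>m n n)) (- 1\<^sub>m n)"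
    by (subst (2) quat_struct_def, subst quat_struct_mult) auto
  also have "\<dots> = - 1\<^sub>m (n + n)"
    by (rule eq_matI) auto
  finally show ?thesis .
qed

lemma complex_rep_quat_struct:
  assumes "A \<in> carrier_mat n n"
  shows "complex_rep A * quat_struct n = quat_struct n * map_mat cnj (complex_rep A)"
  unfolding complex_rep_def
  by (subst map_four_block_mat[of _ n n _ n _ n], use assms in simp_all,
      subst quat_struct_mult, use assms in simp_all, subst mult_quat_struct, use assms in simp_all,
      intro cong_four_block_mat) (use assms in \<open>auto intro!: eq_matI\<close>)

text \<open>Comparing blocks expresses the lower half of \<open>X\<close> through the upper half
  exactly as in \<open>complex_rep\<close>; the upper blocks are then the two complex components of
  \<open>A\<close>.\<close>

lemma complex_rep_surj:
  assumes X: "X \<in> carrier_mat (n + n) (n + n)"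
    and XJ: "X * quat_struct n = quat_struct n * map_mat cnj X"
  obtains A where "A \<in> carrier_mat n n" "X = complex_rep A"
proof -
  obtain X1 X2 X3 X4 where sb: "split_block X n n = (X1, X2, X3, X4)"
    by (metis surj_pair)
  have c: "X1 \<in> carrier_mat n n" "X2 \<in> carrier_mat n n" "X3 \<in> carrier_mat n n" "X4 \<in> carrier_mat n n"
    and X4: "X = four_block_mat X1 X2 X3 X4"
    using split_block[OF sb] X by auto
  let ?c = "map_mat cnj"
  have "four_block_mat (- X2) X1 (- X4) X3 = quat_struct n * four_block_mat (?c X1) (?c X2) (?c X3) (?c X4)"
    using XJ unfolding X4 mult_quat_struct[OF c] map_four_block_mat[OF c] .
  also have "\<dots> = four_block_mat (?c X3) (?c X4) (- ?c X1) (- ?c X2)"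
    by (rule quat_struct_mult) (use c in auto)
  finally have eq: "four_block_mat (- X2) X1 (- X4) X3 = \<dots>" .
  define f where "f z w = (SOME q. quat_fst q = z \<and> quat_snd q = w)" for z w
  have f: "quat_fst (f z w) = z" "quat_snd (f z w) = w" for z w
    using someI_ex[OF quat_fst_snd_surj[of z w]] unfolding f_def by auto
  define A where "A = mat n n (\<lambda>ij. f (X1 $$ ij) (X2 $$ ij))"
  have A: "A \<in> carrier_mat n n" unfolding A_def by simp
  have "X3 $$ (i, j) = - cnj (X2 $$ (i, j))" "X4 $$ (i, j) = cnj (X1 $$ (i, j))" if "i < n" "j < n" for i j
    using arg_cong[OF eq, of "\<lambda>Y. Y $$ (i, j)"] arg_cong[OF eq, of "\<lambda>Y. Y $$ (i, j + n)"] c that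
    by (auto simp: complex_eq_iff)
  then have "X = complex_rep A"
    unfolding complex_rep_def X4
    by (intro cong_four_block_mat) (use c in \<open>auto intro!: eq_matI simp: A_def f\<close>)
  with A show ?thesis by (rule that)
qed

lemma complex_rep_similar:
  assumes "similar_mat A B" "A \<in> carrier_mat n n"
  shows "similar_mat (complex_rep A) (complex_rep B)"
proof -
  obtain m P Q where m: "{A, B, P, Q} \<subseteq> carrier_mat m m"
    and PQ: "P * Q = 1\<^sub>m m" "Q * P = 1\<^sub>m m" "A = P * B * Q"
    using similar_matD[OF assms(1)] by blast
  then have c: "A \<in> carrier_mat m m" "B \<in> carrier_mat m m" "P \<in> carrier_mat m m" "Q \<in> carrier_mat m m"
    by auto
  show ?thesis
  proof (rule similar_matI)
    show "complex_rep P * complex_rep Q = 1\<^sub>m (m + m)" "complex_rep Q * complex_rep P = 1\<^sub>m (m + m)"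
      using c PQ by (simp_all add: complex_rep_mult[symmetric] complex_rep_one)
    show "complex_rep A = complex_rep P * complex_rep B * complex_rep Q"
      unfolding PQ(3) complex_rep_mult[OF mult_carrier_mat[OF c(3,2)] c(4)] complex_rep_mult[OF c(3,2)] ..
  qed (use c in auto)
qed

text \<open>The unit circle is infinite, so it has a point \<open>cis t\<close> outside
  \<open>Z\<close>; take a square root of its negative.\<close>

lemma unit_square_avoiding_finite:
  assumes "finite (Z :: complex set)"
  obtains a where "a * cnj a = 1" "- a\<^sup>2 \<notin> Z"
proof -
  have "inj_on cis {0..1}"
    using cos_inj_pi pi_gt3 by (auto simp: inj_on_def complex_eq_iff)
  then have "infinite (cis ` {0..1})"
    using finite_image_iff infinite_Icc[of 0 "1 :: real"] by fastforce
  then obtain t where t: "cis t \<notin> Z"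
    using assms by (metis finite_subset image_subsetI)
  define a where "a = csqrt (- cis t)"
  have a: "a\<^sup>2 = - cis t" unfolding a_def by simp
  then have "(cmod a)\<^sup>2 = 1"
    by (metis norm_minus_cancel norm_cis norm_power)
  then have "a * cnj a = 1"
    by (metis complex_norm_square of_real_1)
  then show ?thesis using that a t by simp
qed

text \<open>With \<open>\<sigma> P = - J P\<^sup>* J\<close>, the fixed points of \<open>\<sigma>\<close> are the quaternionic matrices. If \<open>P\<close> conjugates
  \<open>\<chi>(B)\<close> to \<open>\<chi>(A)\<close>, so does the fixed point \<open>a P + a\<^sup>* \<sigma> P\<close>, and it is invertible unless
  \<open>-a\<^sup>2\<close> is an eigenvalue of \<open>P\<^sup>-\<^sup>1 \<sigma> P\<close> (for \<open>|a| = 1\<close>).\<close>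

lemma similar_complex_rep_imp_similar:
  assumes A: "A \<in> carrier_mat n n" and B: "B \<in> carrier_mat n n"
    and sim: "similar_mat (complex_rep A) (complex_rep B)"
  shows "similar_mat A B"
proof -
  define N where "N = n + n"
  define J where "J = quat_struct n"
  let ?c = "map_mat cnj"
  let ?A = "complex_rep A" and ?B = "complex_rep B"
  note asc = assoc_mult_mat[of _ N N _ N _ N]
  have J: "J \<in> carrier_mat N N" and cA: "?A \<in> carrier_mat N N" and cB: "?B \<in> carrier_mat N N"
    using A B unfolding J_def N_def by auto
  have JJ: "J * J = - 1\<^sub>m N" and cJ: "?c J = J"
    unfolding J_def N_def by (rule quat_struct_square cnj_quat_struct)+
  obtain m P Q where "{?A, ?B, P, Q} \<subseteq> carrier_mat m m" "P * Q = 1\<^sub>m m" "Q * P = 1\<^sub>m m" "?A = P * ?B * Q"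
    using similar_matD[OF sim] by blast
  moreover from this cA have "m = N" by auto
  ultimately have P: "P \<in> carrier_mat N N" and Q: "Q \<in> carrier_mat N N"
    and PQ: "P * Q = 1\<^sub>m N" and QP: "Q * P = 1\<^sub>m N" and APQ: "?A = P * ?B * Q" by auto
  have AP: "?A * P = P * ?B"
    using APQ P Q cB QP by (simp add: asc)
  have hom: "?c (X * Y) = ?c X * ?c Y" if "X \<in> carrier_mat N N" "Y \<in> carrier_mat N N" for X Y
    using cnj_hom.mat_hom_mult that by blast
  have cc: "?c (?c X) = X" for X by (rule eq_matI) auto
  \<comment> \<open>\<open>R\<close> is -\<sigma> P, which explains the minus sign in the definition
    of \<open>T\<close> below.\<close>
  define R where "R = J * ?c P * J"
  have R: "R \<in> carrier_mat N N" unfolding R_def using J P by auto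
  have cP: "?c P \<in> carrier_mat N N" using P by simp
  have neg: "(- 1\<^sub>m N) * X = - X" "X * (- 1\<^sub>m N) = - X" if "X \<in> carrier_mat N N" for X :: "complex mat"
    using that by auto
  have JJX: "J * (J * X) = - X" if "X \<in> carrier_mat N N" for X
    using asc[OF J J that] JJ neg that by simp
  have cR: "?c R = J * P * J" unfolding R_def
    using J cP by (simp add: hom cJ cc)
  have RJ: "R * J = - (J * ?c P)"
    unfolding R_def using J cP by (simp add: asc JJ neg)
  have JcR: "J * ?c R = - (P * J)"
    unfolding cR using J P by (simp add: asc JJX)
  have AJ: "?A * J = J * ?c ?A" and BJ: "?B * J = J * ?c ?B"
    unfolding J_def using A B by (simp_all add: complex_rep_quat_struct)
  have BJ': "?c ?B * J = J * ?B"
    using arg_cong[OF BJ, of ?c] cB J by (simp add: hom cJ cc)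
  \<comment> \<open>Conjugating \<open>AP\<close> entrywise and moving \<open>J\<close> past both
    sides shows that \<open>R\<close> is a second intertwiner.\<close>
  have "?A * R = J * (?c ?A * ?c P) * J"
  proof -
    have "?A * (J * ?c P) = J * (?c ?A * ?c P)"
      using asc[OF cA J cP] asc[OF J _ cP, of "?c ?A"] AJ cA by simp
    then show ?thesis
      unfolding R_def using asc[OF cA mult_carrier_mat[OF J cP] J] by (simp only:)
  qed
  also have "?c ?A * ?c P = ?c P * ?c ?B"
    using AP hom[OF cA P] hom[OF P cB] by simp
  also have "J * (?c P * ?c ?B) * J = J * (?c P * (?c ?B * J))"
    using J cP cB by (simp add: asc)
  also have "\<dots> = R * ?B"
    unfolding BJ' R_def using J cP cB by (simp add: asc)
  finally have AR: "?A * R = R * ?B" .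
  \<comment> \<open>\<open>M\<close> is the inverse of \<open>P\<close> times \<sigma> P, whose
    eigenvalues \<open>- a\<^sup>2\<close> has to avoid.\<close>
  define M where "M = - (Q * R)"
  have M: "M \<in> carrier_mat N N" unfolding M_def using Q R by simp
  have "char_poly M \<noteq> 0"
    using degree_monic_char_poly[OF M] by auto
  then have "finite {z. poly (char_poly M) z = 0}"
    by (rule poly_roots_finite)
  then obtain a where a: "a * cnj a = 1" and "- a\<^sup>2 \<notin> {z. poly (char_poly M) z = 0}"
    by (rule unit_square_avoiding_finite)
  then have det: "Determinant.det (char_matrix M (- a\<^sup>2)) \<noteq> 0"
    using eigenvalue_root_char_poly[OF M] eigenvalue_det[OF M] by simp
  define T where "T = a \<cdot>\<^sub>m P + (- cnj a) \<cdot>\<^sub>m R"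
  have T: "T \<in> carrier_mat N N" unfolding T_def using P R by simp
  have "T = cnj a \<cdot>\<^sub>m (P * char_matrix M (- a\<^sup>2))"
  proof -
    have "P * char_matrix M (- a\<^sup>2) = P * M + P * (a\<^sup>2 \<cdot>\<^sub>m 1\<^sub>m N)"
      unfolding char_matrix_def using P M mult_add_distrib_mat[OF P M, of "a\<^sup>2 \<cdot>\<^sub>m 1\<^sub>m N"] by simp
    also have "P * M = - R"
    proof -
      have "P * M = - (P * (Q * R))" unfolding M_def using P Q R by simp
      also have "P * (Q * R) = R" using asc[OF P Q R] PQ R by simp
      finally show ?thesis .
    qed
    also have "P * (a\<^sup>2 \<cdot>\<^sub>m 1\<^sub>m N) = a\<^sup>2 \<cdot>\<^sub>m P"
      using mult_smult_distrib[OF P one_carrier_mat] P by simp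
    finally show ?thesis
      unfolding T_def using P R a
      by (intro eq_matI) (auto simp: algebra_simps power2_eq_square)
  qed
  moreover have "Determinant.det P \<noteq> 0"
    using det_mult[OF P Q] PQ by auto
  moreover have "cnj a \<noteq> 0" using a by auto
  ultimately have "Determinant.det T \<noteq> 0"
    using det P M by (simp add: det_mult[OF P])
  then obtain S where S: "S \<in> carrier_mat N N" and TS: "T * S = 1\<^sub>m N" and ST: "S * T = 1\<^sub>m N"
    using det_non_zero_imp_unit[OF T] by (auto simp: Units_def ring_mat_simps)
  have smulL: "(k \<cdot>\<^sub>m X) * Y = k \<cdot>\<^sub>m (X * Y)" and smulR: "X * (k \<cdot>\<^sub>m Y) = k \<cdot>\<^sub>m (X * Y)"
    if "X \<in> carrier_mat N N" "Y \<in> carrier_mat N N" for X Y :: "complex mat" and k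
    using that by (auto intro: mult_smult_assoc_mat mult_smult_distrib)
  have cT: "?c T = cnj a \<cdot>\<^sub>m ?c P + (- a) \<cdot>\<^sub>m ?c R"
    unfolding T_def using P R by (intro eq_matI) auto
  have "T * J = a \<cdot>\<^sub>m (P * J) + (- cnj a) \<cdot>\<^sub>m (R * J)"
    unfolding T_def using add_mult_distrib_mat[of "a \<cdot>\<^sub>m P" N N "(- cnj a) \<cdot>\<^sub>m R" J N] P R J by (simp add: smulL)
  also have "\<dots> = cnj a \<cdot>\<^sub>m (J * ?c P) + (- a) \<cdot>\<^sub>m (J * ?c R)"
    unfolding RJ JcR using P J cP by (intro eq_matI) auto
  also have "\<dots> = J * ?c T"
    unfolding cT using mult_add_distrib_mat[of J N N "cnj a \<cdot>\<^sub>m ?c P" N "(- a) \<cdot>\<^sub>m ?c R"] P R J by (simp add: smulR)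
  finally have TJ: "T * J = J * ?c T" .
  have AT: "?A * T = T * ?B"
    unfolding T_def
    using mult_add_distrib_mat[of ?A N N "a \<cdot>\<^sub>m P" N "(- cnj a) \<cdot>\<^sub>m R"]
      add_mult_distrib_mat[of "a \<cdot>\<^sub>m P" N N "(- cnj a) \<cdot>\<^sub>m R" ?B N] P R cA cB
    by (simp add: smulL smulR AP AR)
  \<comment> \<open>The inverse of \<open>T\<close> respects the structure as well, so both come
    from quaternionic matrices \<open>t\<close> and \<open>s\<close>.\<close>
  have "?c T * ?c S = 1\<^sub>m N"
    using hom[OF T S] TS cnj_hom.mat_hom_one by simp
  then have SJ: "S * J = J * ?c S"
    using intertwining_inverse[OF T _ J S _ ST _ TJ, of "?c S"] T S by simp
  obtain t where t: "t \<in> carrier_mat n n" "T = complex_rep t"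
    using complex_rep_surj[of T n] T TJ unfolding N_def J_def by blast
  obtain s where s: "s \<in> carrier_mat n n" "S = complex_rep s"
    using complex_rep_surj[of S n] S SJ unfolding N_def J_def by blast
  have ts: "t * s = 1\<^sub>m n" and st: "s * t = 1\<^sub>m n"
    using TS ST t s by (auto intro!: complex_rep_inj[of _ n] simp: complex_rep_mult complex_rep_one N_def)
  have "A * t = t * B"
    using AT A B t by (intro complex_rep_inj[of _ n]) (auto simp: complex_rep_mult)
  then have "A = t * B * s"
    using assoc_mult_mat[OF A t(1) s(1)] ts A by simp
  then show ?thesis
    using similar_matI[of A B t s n] A B t s ts st by auto
qed

section \<open>Jordan forms of quaternionic matrices\<close>

text \<open>The relation \<open>complex_rep_quat_struct\<close> is a conjugation, because the
  inverse of \<open>?J\<close> is \<open>- ?J\<close>.\<close>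

lemma similar_complex_rep_cnj:
  assumes "A \<in> carrier_mat n n"
  shows "similar_mat (complex_rep A) (map_mat cnj (complex_rep A))"
proof (rule similar_matI)
  let ?J = "quat_struct n"
  show "?J * - ?J = 1\<^sub>m (n + n)" "- ?J * ?J = 1\<^sub>m (n + n)"
    using quat_struct_square[of n] by (simp_all add: carrier_matD[OF quat_struct_carrier])
  have "complex_rep A = complex_rep A * (?J * - ?J)"
    using quat_struct_square[of n] right_mult_one_mat[OF complex_rep_carrier[OF assms]]
    by (simp add: carrier_matD[OF quat_struct_carrier])
  also have "\<dots> = ?J * map_mat cnj (complex_rep A) * - ?J"
    using assms
    by (subst assoc_mult_mat[of _ "n + n" "n + n" _ "n + n" _ "n + n", symmetric])
      (auto simp: complex_rep_quat_struct)
  finally show "complex_rep A = \<dots>" .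
qed (use assms in auto)

text \<open>For real \<open>e\<close>, the matrix \<chi>(A) - e and its powers commute with the
  quaternionic structure, so their kernels carry it.\<close>

lemma even_dim_gen_eigenspace_complex_rep:
  assumes A: "A \<in> carrier_mat n n" and e: "cnj e = e"
  shows "even (dim_gen_eigenspace (complex_rep A) e k)"
  unfolding dim_gen_eigenspace_def
proof (rule even_kernel_dim_quaternionic_structure)
  let ?J = "quat_struct n" and ?X = "complex_rep A" and ?N = "n + n"
  let ?c = "map_mat cnj"
  have X: "?X \<in> carrier_mat ?N ?N" and cX: "?c ?X \<in> carrier_mat ?N ?N" and J: "?J \<in> carrier_mat ?N ?N"
    using A by auto
  show "char_matrix ?X e ^\<^sub>m k \<in> carrier_mat ?N ?N"
    using A by (intro pow_carrier_mat) simp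
  show "?J \<in> carrier_mat ?N ?N" by simp
  show "?J * ?c ?J = - 1\<^sub>m ?N"
    by (simp add: cnj_quat_struct quat_struct_square)
  \<comment> \<open>This is where \<open>e\<close> has to be real.\<close>
  have c: "?c (char_matrix ?X e) = char_matrix (?c ?X) e"
    using X e by (intro eq_matI) (auto simp: char_matrix_def)
  have "char_matrix ?X e * ?J = ?X * ?J + (- e) \<cdot>\<^sub>m ?J"
    unfolding char_matrix_def
    using X J add_mult_distrib_mat[OF X, of "(- e) \<cdot>\<^sub>m 1\<^sub>m ?N" ?J ?N] mult_smult_assoc_mat[OF one_carrier_mat J, of "- e"]
      left_mult_one_mat[OF J]
    by simp
  also have "\<dots> = ?J * ?c ?X + (- e) \<cdot>\<^sub>m ?J"
    by (simp add: complex_rep_quat_struct[OF A])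
  also have "\<dots> = ?J * char_matrix (?c ?X) e"
    unfolding char_matrix_def
    using X J mult_add_distrib_mat[OF J cX, of "(- e) \<cdot>\<^sub>m 1\<^sub>m ?N"] mult_smult_distrib[OF J one_carrier_mat, of "- e"]
      right_mult_one_mat[OF J]
    by simp
  finally have "char_matrix ?X e * ?J = ?J * ?c (char_matrix ?X e)"
    by (simp add: c)
  then have "char_matrix ?X e ^\<^sub>m k * ?J = ?J * ?c (char_matrix ?X e) ^\<^sub>m k"
    using X J by (intro pow_mat_intertwine[where n = ?N]) auto
  then show "char_matrix ?X e ^\<^sub>m k * ?J = ?J * ?c (char_matrix ?X e ^\<^sub>m k)"
    using cnj_hom.mat_hom_pow[of "char_matrix ?X e" ?N k] X by simp
qed

lemma jordan_blocks_complex_rep_cnj: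
  assumes A: "A \<in> carrier_mat n n" and F: "has_jordan_blocks (complex_rep A) F"
  shows "image_mset (map_prod id cnj) F = F"
  using has_jordan_blocks_unique[OF has_jordan_blocks_cnj[OF F] F]
    dim_gen_eigenspace_similar[OF similar_complex_rep_cnj[OF A]] by simp

text \<open>The number of blocks is computed from dimensions of generalized eigenspaces, all of them
  even.\<close>

lemma even_count_jordan_blocks_complex_rep:
  assumes A: "A \<in> carrier_mat n n" and F: "has_jordan_blocks (complex_rep A) F" and e: "Im e = 0"
  shows "even (count F (m, e))"
proof (cases "m = 0")
  case True
  then show ?thesis using has_jordan_blocks_pos[OF F] by (simp add: not_in_iff)
next
  case False
  have "cnj e = e" using e by (simp add: complex_eq_iff)
  then show ?thesis
    unfolding count_jordan_blocks[OF F False] compute_nr_of_jordan_blocks_def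
    by (simp add: even_dim_gen_eigenspace_complex_rep[OF A] even_diff_nat)
qed

text \<open>Non-real blocks occur in conjugate pairs, from which \<open>b\<close> takes the member
  in the upper half plane. Conjugation fixes the real blocks, and \<open>b\<close> takes half of
  their even multiplicity.\<close>

lemma jordan_blocks_complex_rep_split:
  assumes A: "A \<in> carrier_mat n n" and F: "has_jordan_blocks (complex_rep A) F"
  obtains b where "F = b + image_mset (map_prod id cnj) b" "\<And>m e. (m, e) \<in># b \<Longrightarrow> Im e \<ge> 0"
    "\<And>x. count b x = (if Im (snd x) > 0 then count F x else if Im (snd x) = 0 then count F x div 2 else 0)"
proof -
  define f where "f x = (if Im (snd x) > 0 then count F x else if Im (snd x) = 0 then count F x div 2 else 0)" for x
  define b where "b = Abs_multiset f"
  have "f x \<le> count F x" for x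
    unfolding f_def by simp
  then have "{x. 0 < f x} \<subseteq> set_mset F"
    by (metis (mono_tags, lifting) count_greater_zero_iff less_le_trans mem_Collect_eq subsetI)
  then have "finite {x. 0 < f x}"
    using finite_subset by blast
  then have count_b: "count b = f"
    unfolding b_def by (rule count_Abs_multiset)
  have inj: "inj (map_prod id cnj :: nat \<times> complex \<Rightarrow> _)"
    by (auto simp: inj_def)
  have cnj_count: "count (image_mset (map_prod id cnj) M) x = count M (map_prod id cnj x)"
    for M :: "(nat \<times> complex) multiset" and x
    using count_image_mset_inj[OF inj, of M "map_prod id cnj x"] by (cases x) simp
  have "F = b + image_mset (map_prod id cnj) b"
  proof (rule multiset_eqI)
    fix x :: "nat \<times> complex"
    obtain m e where x: "x = (m, e)" by force
    have "count F x = count F (map_prod id cnj x)"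
      using cnj_count[of F x] jordan_blocks_complex_rep_cnj[OF A F] by simp
    then have sym: "count F (m, e) = count F (m, cnj e)" by (simp add: x)
    consider "Im e > 0" | "Im e < 0" | "Im e = 0" by linarith
    then have "count F (m, e) = f (m, e) + f (m, cnj e)"
    proof cases
      case 3
      then have "cnj e = e" by (simp add: complex_eq_iff)
      then show ?thesis
        using even_count_jordan_blocks_complex_rep[OF A F 3, of m] 3 by (auto simp: f_def elim!: evenE)
    qed (simp_all add: f_def sym)
    then show "count F x = count (b + image_mset (map_prod id cnj) b) x"
      by (simp add: x cnj_count count_b)
  qed
  moreover have "Im e \<ge> 0" if "(m, e) \<in># b" for m e
    using that count_greater_zero_iff[of b "(m, e)"] unfolding count_b f_def by (auto split: if_splits)
  ultimately show ?thesis
    using that[of b] count_b unfolding f_def by auto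
qed

text \<open>For complex \<open>X\<close>, \<chi>(X) is the direct sum of \<open>X\<close> and its
  conjugate. Only \<open>F\<close> together with its conjugate matters, so \<open>F\<close> may
  contain a block for \<open>e\<close> or for \<open>cnj e\<close>; the construction of the
  reversible model relies on this freedom.\<close>

lemma similar_of_complex:
  assumes A: "A \<in> carrier_mat n n" and X: "X \<in> carrier_mat m m"
    and F: "has_jordan_blocks (complex_rep A) (F + image_mset (map_prod id cnj) F)" and XF: "has_jordan_blocks X F"
  shows "m = n" "similar_mat A (map_mat quat_of_complex X)"
proof -
  have "fst \<circ> map_prod id cnj = (fst :: nat \<times> complex \<Rightarrow> _)" by auto
  then have "n + n = m + m"
    using has_jordan_blocks_dim[OF XF X] has_jordan_blocks_dim[OF F complex_rep_carrier[OF A]]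
    by (simp add: multiset.map_comp)
  then show m: "m = n" by simp
  have "has_jordan_blocks (complex_rep (map_mat quat_of_complex X)) (F + image_mset (map_prod id cnj) F)"
    unfolding complex_rep_of_complex[OF X]
    by (rule has_jordan_blocks_four_block[OF XF has_jordan_blocks_cnj[OF XF] X]) (use X in simp)
  from has_jordan_blocks_imp_similar[OF F this]
  show "similar_mat A (map_mat quat_of_complex X)"
    using similar_complex_rep_imp_similar[OF A] X m by simp
qed

text \<open>Produces the quaternionic Jordan form to which the parity hypothesis of the theorem is
  applied.\<close>

lemma quat_jordan_form_of_split:
  assumes A: "A \<in> carrier_mat n n"
    and F: "has_jordan_blocks (complex_rep A) (mset bs + image_mset (map_prod id cnj) (mset bs))"
    and "\<And>m e. (m, e) \<in> set bs \<Longrightarrow> Im e \<ge> 0"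
  shows "quat_jordan_form A bs"
proof -
  have pos: "0 \<notin> fst ` set bs"
    using has_jordan_blocks_pos[OF F] by force
  have "similar_mat A (map_mat quat_of_complex (jordan_matrix bs))"
    by (rule similar_of_complex(2)[OF A jordan_matrix_carrier F has_jordan_blocks_jordan_matrix[OF pos]])
  moreover have "map_prod id quat_of_complex = (\<lambda>(m :: nat, \<mu>). (m, quat_of_complex \<mu>))"
    by (simp add: fun_eq_iff)
  ultimately have "similar_mat A (jordan_matrix (map (\<lambda>(m, \<mu>). (m, quat_of_complex \<mu>)) bs))"
    by (simp only: quat_of_complex_hom.map_jordan_matrix)
  then show ?thesis
    unfolding quat_jordan_form_def jordan_nf_def using pos assms(3) by force
qed

lemma jordan_blocks_invertible_nonzero:
  fixes A :: "'a :: field mat"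
  assumes A: "A \<in> carrier_mat n n" and B: "B \<in> carrier_mat n n"
    and AB: "A * B = 1\<^sub>m n" and BA: "B * A = 1\<^sub>m n" and F: "has_jordan_blocks A F"
  shows "(m, 0) \<notin># F"
proof (cases "m = 0")
  case True
  then show ?thesis using has_jordan_blocks_pos[OF F] by simp
next
  case False
  have "dim_gen_eigenspace A 0 k = 0" for k
  proof -
    have "char_matrix A 0 = A" using A by (auto simp: char_matrix_def)
    then have "dim_gen_eigenspace A 0 k = kernel_dim (1\<^sub>m n ^\<^sub>m k :: 'a mat)"
      unfolding dim_gen_eigenspace_def
      using kernel_dim_unit_mult_pow[OF A one_carrier_mat B _ AB BA] A by simp
    also have "\<dots> = 0"
      unfolding one_pow_mat kernel_dim_def using kernel_one_mat by simp
    finally show ?thesis .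
  qed
  then show ?thesis
    using count_jordan_blocks[OF F False, of 0]
    by (simp add: compute_nr_of_jordan_blocks_def not_in_iff)
qed

section \<open>Pairing the Jordan blocks\<close>

text \<open>Inversion composed with conjugation. Since 1 / \<open>cnj e\<close> is a positive
  multiple of \<open>e\<close> for nonzero \<open>e\<close>, this symmetry preserves the closed
  upper half plane and acts on the blocks of a quaternionic Jordan form.\<close>

definition dual_block :: "nat \<times> complex \<Rightarrow> nat \<times> complex" where
  "dual_block = map_prod id (\<lambda>e. inverse (cnj e))"

lemma dual_block_simp [simp]: "dual_block (m, e) = (m, inverse (cnj e))"
  by (simp add: dual_block_def)

lemma dual_block_involution [simp]: "dual_block (dual_block x) = x"
  by (cases x) simp

lemma dual_block_eq_iff: "dual_block x = y \<longleftrightarrow> x = dual_block y"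
  by (metis dual_block_involution)

lemma inverse_cnj_fixed_iff:
  assumes "e \<noteq> 0"
  shows "inverse (cnj e) = e \<longleftrightarrow> cmod e = 1"
proof -
  have "inverse (cnj e) = e \<longleftrightarrow> e * cnj e = 1"
    using assms by (auto simp: field_simps)
  also have "\<dots> \<longleftrightarrow> complex_of_real ((cmod e)\<^sup>2) = complex_of_real 1"
    by (simp only: complex_norm_square of_real_1)
  also have "\<dots> \<longleftrightarrow> (cmod e)\<^sup>2 = 1\<^sup>2"
    by (simp only: of_real_eq_iff power_one)
  also have "\<dots> \<longleftrightarrow> cmod e = 1"
    by (rule power2_eq_iff_nonneg) simp_all
  finally show ?thesis .
qed

lemma Im_inverse_cnj:
  "0 < Im (inverse (cnj e)) \<longleftrightarrow> 0 < Im e" "Im (inverse (cnj e)) = 0 \<longleftrightarrow> Im e = 0"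
proof -
  have *: "Im (inverse (cnj e)) = Im e / (cmod e)\<^sup>2"
    by (simp add: cmod_power2)
  show "0 < Im (inverse (cnj e)) \<longleftrightarrow> 0 < Im e" "Im (inverse (cnj e)) = 0 \<longleftrightarrow> Im e = 0"
    unfolding * by (cases "e = 0"; simp add: zero_less_divide_iff)+
qed

text \<open>The induction invariant for pairing blocks. For nonzero \<open>e\<close>,
  \<open>dual_block\<close> fixes exactly the blocks with \<open>cmod e = 1\<close>; by the parity
  condition the non-real ones among them can be paired with copies of themselves.\<close>

definition self_dual_blocks :: "(nat \<times> complex) multiset \<Rightarrow> bool" where
  "self_dual_blocks b \<longleftrightarrow> (\<forall>m e. (m, e) \<in># b \<longrightarrow> m \<noteq> 0 \<and> e \<noteq> 0) \<and>
     (\<forall>x. count b (dual_block x) = count b x) \<and>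
     (\<forall>m e. cmod e = 1 \<longrightarrow> Im e \<noteq> 0 \<longrightarrow> even (count b (m, e)))"

lemma self_dual_blocks_remove_fixed:
  assumes b: "self_dual_blocks (add_mset u c)" and u: "dual_block u = u" "Im (snd u) = 0"
  shows "self_dual_blocks c"
  unfolding self_dual_blocks_def
proof (intro conjI allI impI)
  fix m e assume "(m, e) \<in># c"
  then show "m \<noteq> 0" "e \<noteq> 0" using b unfolding self_dual_blocks_def by auto
next
  fix x
  have "count (add_mset u c) (dual_block x) = count (add_mset u c) x"
    using b unfolding self_dual_blocks_def by blast
  moreover have "u = dual_block x \<longleftrightarrow> u = x" using u dual_block_eq_iff by metis
  ultimately show "count c (dual_block x) = count c x" by (simp split: if_splits)
next
  fix m e assume "cmod e = 1" "Im e \<noteq> 0"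
  moreover from this have "u \<noteq> (m, e)" using u by auto
  ultimately show "even (count c (m, e))"
    using b unfolding self_dual_blocks_def by (metis count_add_mset)
qed

text \<open>The parity condition concerns blocks fixed by \<open>dual_block\<close>. Such a block
  equals \<open>u\<close> iff it equals \<open>dual_block u\<close>, so its count drops by 0 or
  2.\<close>

lemma self_dual_blocks_remove_pair:
  assumes b: "self_dual_blocks (add_mset u (add_mset (dual_block u) c))"
  shows "self_dual_blocks c"
  unfolding self_dual_blocks_def
proof (intro conjI allI impI)
  fix m e assume "(m, e) \<in># c"
  then show "m \<noteq> 0" "e \<noteq> 0" using b unfolding self_dual_blocks_def by auto
next
  let ?b = "add_mset u (add_mset (dual_block u) c)"
  fix x
  have "count ?b (dual_block x) = count ?b x"
    using b unfolding self_dual_blocks_def by blast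
  moreover have "u = dual_block x \<longleftrightarrow> dual_block u = x" "dual_block u = dual_block x \<longleftrightarrow> u = x"
    by (metis dual_block_involution)+
  ultimately show "count c (dual_block x) = count c x" by (simp split: if_splits)
next
  let ?b = "add_mset u (add_mset (dual_block u) c)"
  fix m e assume e: "cmod e = 1" "Im e \<noteq> 0"
  then have "e \<noteq> 0" by auto
  with e have "dual_block (m, e) = (m, e)"
    using inverse_cnj_fixed_iff[of e] by simp
  then have "dual_block u = (m, e) \<longleftrightarrow> u = (m, e)"
    by (metis dual_block_involution)
  moreover have "even (count ?b (m, e))"
    using b e unfolding self_dual_blocks_def by blast
  ultimately show "even (count c (m, e))" by (simp split: if_splits)
qed

text \<open>Induction on the number of blocks, splitting off a single block for \<open>e\<close> = 1
  or -1 and a dual pair otherwise. The multiset is matched only after adding conjugates, because a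
  pair for \<open>e\<close> and 1 / \<open>cnj e\<close> is realized by a block for \<open>e\<close>
  and its inverse, with eigenvalue 1 / \<open>e\<close>.\<close>

lemma strongly_reversible_complex_exists:
  assumes "self_dual_blocks b"
  shows "\<exists>X N F. mat_strongly_reversible N X \<and> has_jordan_blocks X F \<and>
    F + image_mset (map_prod id cnj) F = b + image_mset (map_prod id cnj) b"
  using assms
proof (induction "size b" arbitrary: b rule: less_induct)
  case less
  let ?c = "image_mset (map_prod id cnj) :: (nat \<times> complex) multiset \<Rightarrow> _"
  show ?case
  proof (cases "b = {#}")
    case True
    have "mat_strongly_reversible 0 (1\<^sub>m 0 :: complex mat)"
      unfolding mat_strongly_reversible_def
      by (intro conjI bexI[of _ "1\<^sub>m 0"]) auto
    moreover have "jordan_matrix [] = (1\<^sub>m 0 :: complex mat)"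
      by (rule eq_matI) auto
    then have "has_jordan_blocks (1\<^sub>m 0 :: complex mat) {#}"
      using has_jordan_blocks_jordan_matrix[of "[] :: (nat \<times> complex) list"] by simp
    ultimately show ?thesis using True
      by (intro exI[of _ "1\<^sub>m 0"] exI[of _ "0 :: nat"] exI[of _ "{#}"]) simp
  next
    case False
    then obtain m e where u: "(m, e) \<in># b"
      by (metis multiset_nonemptyE surj_pair)
    then have m: "m \<noteq> 0" and e: "e \<noteq> 0"
      using less.prems unfolding self_dual_blocks_def by auto
    show ?thesis
    proof (cases "e * e = 1")
      case True
      then have "e = 1 \<or> e = - 1" by (simp add: square_eq_1_iff)
      then have ce: "cnj e = e" and ie: "inverse e = e" and Im: "Im e = 0" by auto
      obtain c where c: "b = add_mset (m, e) c"
        using u by (metis insert_DiffM)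
      have "self_dual_blocks c"
        using less.prems unfolding c
        by (rule self_dual_blocks_remove_fixed) (simp_all add: ce ie Im)
      then obtain X N F where X: "mat_strongly_reversible N X" "has_jordan_blocks X F" "F + ?c F = c + ?c c"
        using less.hyps[of c] c by auto
      obtain Y where Y: "mat_strongly_reversible m Y" "has_jordan_blocks Y {#(m, e)#}"
        using strongly_reversible_single_jordan_block[OF m True] by blast
      have cX: "X \<in> carrier_mat N N" and cY: "Y \<in> carrier_mat m m"
        using X Y unfolding mat_strongly_reversible_def by auto
      have "mat_strongly_reversible (m + N) (four_block_mat Y (0\<^sub>m m N) (0\<^sub>m N m) X)"
        "has_jordan_blocks (four_block_mat Y (0\<^sub>m m N) (0\<^sub>m N m) X) ({#(m, e)#} + F)"
        by (rule mat_strongly_reversible_four_block[OF Y(1) X(1)]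
            has_jordan_blocks_four_block[OF Y(2) X(2) cY cX])+
      moreover have "({#(m, e)#} + F) + ?c ({#(m, e)#} + F) = b + ?c b"
        using X(3) by (simp add: c)
      ultimately show ?thesis by blast
    next
      case e2: False
      define e' where "e' = inverse (cnj e)"
      \<comment> \<open>If \<open>e' \<noteq> e\<close>, symmetry supplies the partner. Otherwise
        \<open>e\<close> lies on the unit circle and, as \<open>e * e \<noteq> 1\<close>, is not
        real; its even positive multiplicity supplies a second copy.\<close>
      have "\<exists>c. b = add_mset (m, e) (add_mset (m, e') c)"
      proof (cases "e' = e")
        case False
        have "count b (m, e') = count b (m, e)"
          using less.prems unfolding self_dual_blocks_def e'_def by (metis dual_block_simp)
        then have "(m, e') \<in># b" using u by (metis count_eq_zero_iff)
        then have "(m, e') \<in># b - {#(m, e)#}" using False by (simp add: in_diff_count)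
        then show ?thesis using u by (metis insert_DiffM)
      next
        case True
        then have e1: "cmod e = 1" using inverse_cnj_fixed_iff[OF e] unfolding e'_def by simp
        have "Im e \<noteq> 0"
        proof
          assume "Im e = 0"
          then have "cnj e = e" by (simp add: complex_eq_iff)
          then have "inverse e = e" using True by (simp add: e'_def)
          then show False using e2 e by (metis right_inverse)
        qed
        then have "even (count b (m, e))"
          using less.prems e1 unfolding self_dual_blocks_def by blast
        moreover have "count b (m, e) > 0" using u by simp
        ultimately have "count b (m, e) > 1" by (metis One_nat_def Suc_lessI odd_one)
        then have "(m, e) \<in># b - {#(m, e)#}" by (simp add: in_diff_count)
        then show ?thesis using u True by (metis insert_DiffM)
      qed
      then obtain c where c: "b = add_mset (m, e) (add_mset (m, e') c)" by blast
      have "self_dual_blocks c"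
        by (rule self_dual_blocks_remove_pair[of "(m, e)"]) (use less.prems in \<open>simp add: c e'_def\<close>)
      then obtain X N F where X: "mat_strongly_reversible N X" "has_jordan_blocks X F" "F + ?c F = c + ?c c"
        using less.hyps[of c] c by auto
      let ?L = "jordan_block m e"
      obtain L' where L': "L' \<in> carrier_mat m m" "?L * L' = 1\<^sub>m m" "L' * ?L = 1\<^sub>m m"
        by (rule upper_triangular_mat_inverse[OF jordan_block_carrier[of m e]])
          (use e in \<open>auto simp: upper_triangular_def jordan_block_def\<close>)
      let ?Y = "four_block_mat ?L (0\<^sub>m m m) (0\<^sub>m m m) L'"
      have Y: "mat_strongly_reversible (m + m) ?Y"
        by (rule mat_strongly_reversible_inverse_pair[OF jordan_block_carrier L'])
      have "has_jordan_blocks L' {#(m, inverse e)#}"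
        using has_jordan_blocks_inverse[OF jordan_block_carrier L' has_jordan_blocks_jordan_block[OF m]] by simp
      then have Y': "has_jordan_blocks ?Y {#(m, e), (m, inverse e)#}"
        using has_jordan_blocks_four_block[OF has_jordan_blocks_jordan_block[OF m] _ jordan_block_carrier L'(1)]
        by (simp add: add_mset_commute)
      have cX: "X \<in> carrier_mat N N" and cY: "?Y \<in> carrier_mat (m + m) (m + m)"
        using X Y unfolding mat_strongly_reversible_def by auto
      have "mat_strongly_reversible (m + m + N) (four_block_mat ?Y (0\<^sub>m (m + m) N) (0\<^sub>m N (m + m)) X)"
        "has_jordan_blocks (four_block_mat ?Y (0\<^sub>m (m + m) N) (0\<^sub>m N (m + m)) X) ({#(m, e), (m, inverse e)#} + F)"
        by (rule mat_strongly_reversible_four_block[OF Y X(1)]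
            has_jordan_blocks_four_block[OF Y' X(2) cY cX])+
      \<comment> \<open>The conjugate of \<open>inverse e\<close> is \<open>e'\<close>, so the two
        pairs agree once conjugates are added.\<close>
      moreover have "({#(m, e), (m, inverse e)#} + F) + ?c ({#(m, e), (m, inverse e)#} + F) = b + ?c b"
        using X(3) by (simp add: c e'_def add_mset_commute)
      ultimately show ?thesis by blast
    qed
  qed
qed

section \<open>Translation to the group of invertible quaternionic matrices, and the
  conclusion\<close>

lemma mat_strongly_reversible_GL_quat:
  assumes "mat_strongly_reversible n A"
  shows "strongly_reversible (GL_quat n) A"
proof -
  obtain Y H where A: "A \<in> carrier_mat n n" "Y \<in> carrier_mat n n" "H \<in> carrier_mat n n"
    and YH: "A * Y = 1\<^sub>m n" "Y * A = 1\<^sub>m n" "H * H = 1\<^sub>m n" "H * A = Y * H"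
    using assms unfolding mat_strongly_reversible_def by blast
  interpret group "GL_quat n" by (rule group_GL_quat)
  have mult: "x \<otimes>\<^bsub>GL_quat n\<^esub> y = x * y" for x y
    by (simp add: GL_quat_def units_of_def ring_mat_simps)
  have one: "\<one>\<^bsub>GL_quat n\<^esub> = 1\<^sub>m n"
    by (simp add: GL_quat_def units_of_def ring_mat_simps)
  have carr: "A \<in> carrier (GL_quat n)" "Y \<in> carrier (GL_quat n)" "H \<in> carrier (GL_quat n)"
    using A YH unfolding carrier_GL_quat by auto
  have "inv\<^bsub>GL_quat n\<^esub> A = Y" "inv\<^bsub>GL_quat n\<^esub> H = H"
    using carr YH by (auto intro!: inv_equality simp: mult one)
  moreover have "H * A * H = Y"
    using assoc_mult_mat[OF A(2,3,3)] A(2) YH by simp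
  ultimately show ?thesis
    unfolding strongly_reversible_def using carr YH by (auto simp: mult one)
qed

lemma reversible_GL_quat:
  assumes "reversible (GL_quat n) A"
  obtains B where "A \<in> carrier_mat n n" "B \<in> carrier_mat n n" "A * B = 1\<^sub>m n" "B * A = 1\<^sub>m n" "similar_mat B A"
proof -
  interpret group "GL_quat n" by (rule group_GL_quat)
  have mult: "x \<otimes>\<^bsub>GL_quat n\<^esub> y = x * y" for x y
    by (simp add: GL_quat_def units_of_def ring_mat_simps)
  have one: "\<one>\<^bsub>GL_quat n\<^esub> = 1\<^sub>m n"
    by (simp add: GL_quat_def units_of_def ring_mat_simps)
  obtain h where A: "A \<in> carrier (GL_quat n)" and h: "h \<in> carrier (GL_quat n)"
    and hA: "h * A * inv\<^bsub>GL_quat n\<^esub> h = inv\<^bsub>GL_quat n\<^esub> A"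
    using assms unfolding reversible_def mult by blast
  have c: "x \<in> carrier_mat n n" if "x \<in> carrier (GL_quat n)" for x
    using that unfolding carrier_GL_quat by simp
  have inv: "x * inv\<^bsub>GL_quat n\<^esub> x = 1\<^sub>m n" "inv\<^bsub>GL_quat n\<^esub> x * x = 1\<^sub>m n" if "x \<in> carrier (GL_quat n)" for x
    using r_inv[OF that] l_inv[OF that] unfolding mult one .
  have "similar_mat (inv\<^bsub>GL_quat n\<^esub> A) A"
    by (rule similar_matI[of _ _ h "inv\<^bsub>GL_quat n\<^esub> h" n]) (use A h hA inv c inv_closed in auto)
  then show ?thesis
    using that[of "inv\<^bsub>GL_quat n\<^esub> A"] A c inv inv_closed by auto
qed

theorem theorem5p4:
  fixes n :: nat and A :: "quat mat"
  assumes "A \<in> carrier (GL_quat n)"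
    and "reversible (GL_quat n) A"
    and "\<And>bs \<mu> m. quat_jordan_form A bs \<Longrightarrow> cmod \<mu> = 1 \<Longrightarrow> Im \<mu> > 0 \<Longrightarrow> m \<ge> 1 \<Longrightarrow>
           even (count_list bs (m, \<mu>))"
  shows "strongly_reversible (GL_quat n) A"
proof -
  let ?c = "image_mset (map_prod id cnj) :: (nat \<times> complex) multiset \<Rightarrow> _"
  obtain B where A: "A \<in> carrier_mat n n" and B: "B \<in> carrier_mat n n"
    and AB: "A * B = 1\<^sub>m n" and BA: "B * A = 1\<^sub>m n" and sim: "similar_mat B A"
    using reversible_GL_quat[OF assms(2)] by blast
  have cA: "complex_rep A \<in> carrier_mat (n + n) (n + n)" and cB: "complex_rep B \<in> carrier_mat (n + n) (n + n)"
    using A B by simp_all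
  have cAB: "complex_rep A * complex_rep B = 1\<^sub>m (n + n)" and cBA: "complex_rep B * complex_rep A = 1\<^sub>m (n + n)"
    using A B AB BA by (simp_all add: complex_rep_mult[symmetric] complex_rep_one)
  obtain F where F: "has_jordan_blocks (complex_rep A) F"
    by (rule has_jordan_blocks_exists[OF cA])
  \<comment> \<open>Reversibility makes \<chi> of the inverse similar to \<chi>(A), so
    \<open>F\<close> is stable under inversion of eigenvalues.\<close>
  have inv_F: "image_mset (map_prod id inverse) F = F"
    using has_jordan_blocks_unique[OF has_jordan_blocks_inverse[OF cA cB cAB cBA F] F]
      dim_gen_eigenspace_similar[OF complex_rep_similar[OF sim B]] by simp
  have "image_mset dual_block F = image_mset (map_prod id inverse) (?c F)"
    by (auto simp: multiset.map_comp intro!: image_mset_cong)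
  then have dual_F: "image_mset dual_block F = F"
    using inv_F jordan_blocks_complex_rep_cnj[OF A F] by simp
  obtain b where Fb: "F = b + ?c b" and Im_b: "\<And>m e. (m, e) \<in># b \<Longrightarrow> Im e \<ge> 0"
    and count_b: "\<And>x. count b x = (if Im (snd x) > 0 then count F x else if Im (snd x) = 0 then count F x div 2 else 0)"
    using jordan_blocks_complex_rep_split[OF A F] by metis
  obtain bs where bs: "mset bs = b" using ex_mset by blast
  have jf: "quat_jordan_form A bs"
    by (rule quat_jordan_form_of_split[OF A]) (use F Fb Im_b bs in auto)
  have "self_dual_blocks b"
    unfolding self_dual_blocks_def
  proof (intro conjI allI impI)
    fix m e assume "(m, e) \<in># b"
    then have "(m, e) \<in># F" unfolding Fb by simp
    then show "m \<noteq> 0" "e \<noteq> 0"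
      using has_jordan_blocks_pos[OF F] jordan_blocks_invertible_nonzero[OF cA cB cAB cBA F] by metis+
  next
    fix x :: "nat \<times> complex"
    have "inj dual_block" by (metis dual_block_involution injI)
    then have "count F (dual_block x) = count F x"
      using count_image_mset_inj[of dual_block F x] dual_F by simp
    \<comment> \<open>The formula for \<open>count b\<close> distinguishes only the sign of the
      imaginary part, which \<open>dual_block\<close> preserves.\<close>
    then show "count b (dual_block x) = count b x"
      unfolding count_b by (cases x) (simp only: dual_block_simp snd_conv Im_inverse_cnj)
  next
    fix m e assume e: "cmod e = 1" "Im e \<noteq> 0"
    show "even (count b (m, e))"
    proof (cases "(m, e) \<in># b")
      case True
      then have "m \<noteq> 0" using has_jordan_blocks_pos[OF F] unfolding Fb by (metis union_iff)
      moreover have "Im e > 0" using Im_b[OF True] e by simp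
      ultimately have "even (count_list bs (m, e))"
        using assms(3)[OF jf e(1)] by simp
      then show ?thesis by (simp add: bs[symmetric] count_mset)
    qed (simp add: not_in_iff)
  qed
  \<comment> \<open>\<open>G\<close> may differ from \<open>b\<close>, but together with its
    conjugate it gives the blocks of \<chi>(A), which is all that \<open>similar_of_complex\<close>
    asks for.\<close>
  from strongly_reversible_complex_exists[OF this]
  obtain X N G where X: "mat_strongly_reversible N X" "has_jordan_blocks X G" "G + ?c G = F"
    using Fb by blast
  have "X \<in> carrier_mat N N" using X(1) unfolding mat_strongly_reversible_def by blast
  then have "N = n" "similar_mat A (map_mat quat_of_complex X)"
    using similar_of_complex[OF A] X(2,3) F by metis+
  then have "mat_strongly_reversible n A"
    using quat_of_complex_hom.mat_strongly_reversible_hom[OF X(1)] mat_strongly_reversible_similar by blast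
  then show ?thesis by (rule mat_strongly_reversible_GL_quat)
qed

end
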